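(* Let $P \subseteq \mathbb{R}^d$ be a $d$-dimensional polytope with vertices in $\mathbb{Z}^d$ and no integral points in its interior, such that for every rational line $g$ through the origin the set $P + g$ contains an integral point in its interior. Then $\operatorname{ld}(P) \le s_d - 1$, with equality if and only if $P$ is unimodularly equivalent to $S^d_0 = \operatorname{conv}(\{0, s_1e_1, \ldots, s_{d-1}e_{d-1}, (s_d-1)e_d\})$.
   Context: The Sylvester sequence: $s_1 = 2$, $s_i = \prod_{j=1}^{i-1} s_j + 1$ for $i\ge2$. The lattice diameter $\operatorname{ld}(P)$ is the maximum of $|P\cap\mathbb{Z}^d\cap g| - 1$ over all rational lines $g$. A line $g$ is rational if it is spanned by a rational vector. Unimodular equivalence: existence of an affine bijection of $\mathbb{R}^d$ preserving $\mathbb{Z}^d$ mapping one onto the other. *)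

theory Defs
  imports "HOL-Analysis.Analysis"
begin

text \<open>Sylvester sequence: s 1 = 2, s i = (prod of s j, j = 1..i-1) + 1 for i >= 2.
  (The value at 0 is irrelevant and set to 2.)\<close>
function sylvester :: "nat \<Rightarrow> nat" where
  "sylvester n = (if n \<le> 1 then 2 else (\<Prod>j\<in>{1..<n}. sylvester j) + 1)"
  by pat_completeness auto
termination by (relation "Wellfounded.measure id") auto

definition integral_points :: "(real ^ 'n) set" where
  "integral_points = {x. \<forall>i. x $ i \<in> \<int>}"

definition rational_vec :: "real ^ 'n \<Rightarrow> bool" where
  "rational_vec v \<longleftrightarrow> (\<forall>i. v $ i \<in> \<rat>)"

definition rational_line :: "(real ^ 'n) set \<Rightarrow> bool" where
  "rational_line g \<longleftrightarrow> (\<exists>a v. v \<noteq> 0 \<and> rational_vec v \<and> g = {a + t *\<^sub>R v | t. True})"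

definition lattice_diameter :: "(real ^ 'n) set \<Rightarrow> nat" where
  "lattice_diameter P = (SUP g \<in> {g. rational_line g}. card (P \<inter> integral_points \<inter> g)) - 1"

definition unimodularly_equivalent :: "(real ^ 'n) set \<Rightarrow> (real ^ 'n) set \<Rightarrow> bool" where
  "unimodularly_equivalent P Q \<longleftrightarrow>
     (\<exists>f L b. linear L \<and> (\<forall>x. f x = L x + b) \<and> bij f \<and>
        f ` integral_points = integral_points \<and> f ` P = Q)"

text \<open>The simplex S^d_0 = conv{0, s_1 e_1, ..., s_{d-1} e_{d-1}, (s_d - 1) e_d}, where the
  standard basis vectors e_1..e_d are indexed via a bijection \<iota> from {1..d} to the index type.\<close>
definition simplex_S0 :: "(nat \<Rightarrow> 'n::finite) \<Rightarrow> (real ^ 'n) set" where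
  "simplex_S0 \<iota> = convex hull (insert 0
      ({real (sylvester i) *\<^sub>R axis (\<iota> i) 1 | i. i \<in> {1..<CARD('n)}} \<union>
       {(real (sylvester CARD('n)) - 1) *\<^sub>R axis (\<iota> CARD('n)) 1}))"

end

theory Submission
  imports Defs
begin

text \<open>
  Let \<open>p\<close> and \<open>p + l w\<close> lie in \<open>P\<close> with \<open>p\<close>, \<open>w\<close> integral, and project along \<open>w\<close>. By assumption
  the projection has a lattice point in its interior; it lies in the relative interior of a simplex
  with vertices \<open>p, v\<^sub>1, \<dots>, v\<^sub>k\<close> among the lattice points of \<open>P\<close> (modulo \<open>w\<close>), where \<open>k \<le> d - 1\<close>.
  The fibre of \<open>P\<close> over a lattice point of this simplex with barycentric coordinates
  \<open>\<beta>\<^sub>0, \<dots>, \<beta>\<^sub>k\<close> has length at least \<open>\<beta>\<^sub>0 l\<close>, and it has length at most 1 because \<open>P\<close> is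
  lattice-free; hence \<open>l \<le> 1 / \<beta>\<^sub>0\<close>. If \<open>\<beta>\<^sub>0\<close> is nearly maximal, a pigeonhole argument shows
  \<open>\<Prod>\<^sub>K \<beta>\<^sub>i \<le> 1 - \<Sum>\<^sub>K \<beta>\<^sub>i\<close> for all \<open>K \<subseteq> {1, \<dots>, k}\<close>, and these inequalities force
  \<open>\<Sum> \<beta>\<^sub>i \<le> \<Sum> 1 / s\<^sub>i\<close>, that is \<open>\<beta>\<^sub>0 \<ge> 1 / (s\<^bsub>k+1\<^esub> - 1)\<close>, with equality only for
  \<open>\<beta>\<^sub>i = 1 / s\<^sub>i\<close>. In the extremal case the pairwise coprimality of the \<open>s\<^sub>i\<close> makes the vectors
  \<open>(v\<^sub>i - p) / s\<^sub>i\<close> integral, and lattice-freeness makes them, together with \<open>w\<close>, a lattice basis.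
\<close>

section \<open>Sums and products bounded by the Sylvester sequence\<close>

declare sylvester.simps [simp del]

text \<open>Counting from 0 lets the recursion cover the first term too, where the empty product
  gives 2.\<close>

lemma sylvester_Suc: "sylvester (Suc k) = (\<Prod>i<k. sylvester (Suc i)) + 1"
proof -
  have "sylvester (Suc k) = (\<Prod>j\<in>{1..<Suc k}. sylvester j) + 1"
    by (subst sylvester.simps) auto
  also have "(\<Prod>j\<in>{1..<Suc k}. sylvester j) = (\<Prod>i<k. sylvester (Suc i))"
    by (rule prod.reindex_bij_witness[where i=Suc and j="\<lambda>i. i - 1"]) auto
  finally show ?thesis .
qed

lemma sylvester_pos: "sylvester n > 0"
  by (subst sylvester.simps) auto

lemma sylvester_ge_2: "sylvester n \<ge> 2"
  using sylvester_pos by (subst sylvester.simps) (auto simp: Suc_le_eq intro!: prod_pos)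

lemma sylvester_strict_mono:
  assumes "m < n" "0 < m"
  shows "sylvester m < sylvester n"
proof -
  have *: "sylvester (Suc k) < sylvester (Suc (Suc k))" for k
  proof -
    have "sylvester (Suc (Suc k)) = (\<Prod>i<k. sylvester (Suc i)) * sylvester (Suc k) + 1"
      by (subst sylvester_Suc) simp
    moreover have "(\<Prod>i<k. sylvester (Suc i)) \<ge> 1"
      using sylvester_pos by (simp add: Suc_le_eq prod_pos)
    ultimately show ?thesis
      by (metis add.commute less_Suc_eq_le mult_le_mono1 nat_mult_1 plus_1_eq_Suc)
  qed
  obtain m' n' where "m = Suc m'" "n = Suc n'"
    using assms by (metis Suc_lessE gr0_conv_Suc)
  thus ?thesis
    using lift_Suc_mono_less[of "\<lambda>k. sylvester (Suc k)" m' n'] * assms by simp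
qed

text \<open>The later term is one more than a multiple of the earlier one.\<close>

lemma sylvester_coprime:
  assumes "i < j"
  shows "coprime (sylvester (Suc i)) (sylvester (Suc j))"
proof -
  have "sylvester (Suc i) dvd (\<Prod>i<j. sylvester (Suc i))"
    using assms by (intro dvd_prodI) auto
  hence "sylvester (Suc i) dvd sylvester (Suc j) - 1"
    by (subst (2) sylvester_Suc) simp
  thus ?thesis
    using sylvester_pos[of "Suc j"]
    by (metis One_nat_def Suc_pred coprime_Suc_right_nat coprime_divisors dvd_refl coprime_commute coprime_diff_one_left_nat)
qed

text \<open>If \<open>N\<close> is the product of the first \<open>k\<close> terms, the next term is
  \<open>N + 1\<close>, and \<open>1 / N - 1 / (N + 1) = 1 / (N * (N + 1))\<close> makes the sum
  telescope.\<close>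

lemma sum_inverse_sylvester:
  "(\<Sum>i<k. 1 / real (sylvester (Suc i))) = 1 - 1 / (\<Prod>i<k. real (sylvester (Suc i)))"
proof (induction k)
  case (Suc k)
  define N where "N = (\<Prod>i<k. real (sylvester (Suc i)))"
  have "N > 0" unfolding N_def using sylvester_pos by (intro prod_pos) auto
  have s: "real (sylvester (Suc k)) = N + 1"
    unfolding N_def by (subst sylvester_Suc) simp
  have "(\<Sum>i<Suc k. 1 / real (sylvester (Suc i))) = 1 - 1 / N + 1 / (N + 1)"
    using Suc by (simp add: N_def[symmetric] s)
  also have "\<dots> = 1 - 1 / (N * (N + 1))"
    using \<open>N > 0\<close> by (simp add: divide_simps) (simp add: algebra_simps)
  finally show ?case by (simp add: N_def[symmetric] s)
qed auto

lemma sum_inverse_sylvester':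
  "(\<Sum>i<k. 1 / real (sylvester (Suc i))) = 1 - 1 / (real (sylvester (Suc k)) - 1)"
  using sum_inverse_sylvester[of k] sylvester_Suc[of k] by simp

text \<open>Since \<open>x - y \<ge> y ln (x / y)\<close>, Abel summation against the decreasing weights \<open>y\<close>
  reduces the comparison of sums to the comparison of partial products.\<close>
lemma sum_le_of_partial_prod_le:
  fixes x y :: "nat \<Rightarrow> real"
  assumes pos: "\<And>i. i < n \<Longrightarrow> x i > 0" "\<And>i. i < n \<Longrightarrow> y i > 0"
    and dec: "\<And>i. Suc i < n \<Longrightarrow> y (Suc i) \<le> y i"
    and prods: "\<And>j. j \<le> n \<Longrightarrow> (\<Prod>i<j. y i) \<le> (\<Prod>i<j. x i)"
  shows "(\<Sum>i<n. y i) \<le> (\<Sum>i<n. x i)"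
    and "(\<Sum>i<n. y i) = (\<Sum>i<n. x i) \<Longrightarrow> \<forall>i<n. x i = y i"
proof -
  define g where "g i = ln (x i / y i)" for i
  have G: "(\<Sum>i<j. g i) \<ge> 0" if "j \<le> n" for j
  proof -
    have "(\<Sum>i<j. g i) = ln (\<Prod>i<j. x i / y i)"
      unfolding g_def using pos that by (subst ln_prod) (auto simp: less_le_trans less_imp_neq[symmetric])
    moreover have "(\<Prod>i<j. x i / y i) \<ge> 1"
      using prods[OF that] prod_pos[of "{..<j}" y] pos(2) that by (simp add: prod_dividef)
    ultimately show ?thesis by simp
  qed
  have abel: "(\<Sum>i<Suc m. y i * g i) \<ge> y m * (\<Sum>i<Suc m. g i)" if "m < n" for m
    using that
  proof (induction m)
    case (Suc m)
    have "y (Suc m) * (\<Sum>i<Suc m. g i) \<le> y m * (\<Sum>i<Suc m. g i)"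
      using G[of "Suc m"] dec[of m] Suc.prems by (intro mult_right_mono) auto
    thus ?case using Suc by (simp add: distrib_left)
  qed auto
  have nonneg: "(\<Sum>i<n. y i * g i) \<ge> 0"
  proof (cases n)
    case (Suc m)
    have "0 \<le> y m * (\<Sum>i<Suc m. g i)"
      using G[of n] Suc pos(2)[of m] by (intro mult_nonneg_nonneg) auto
    thus ?thesis using abel[of m] Suc by simp
  qed auto
  have le: "y i * g i \<le> x i - y i" if "i < n" for i
  proof -
    have "g i \<le> x i / y i - 1"
      unfolding g_def using pos[OF that] by (intro ln_le_minus_one) auto
    hence "y i * g i \<le> y i * (x i / y i - 1)"
      using pos(2)[OF that] by (intro mult_left_mono) auto
    thus ?thesis using pos(2)[OF that] by (simp add: right_diff_distrib)
  qed
  have "(\<Sum>i<n. y i * g i) \<le> (\<Sum>i<n. x i - y i)"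
    by (intro sum_mono) (use le in auto)
  with nonneg show "(\<Sum>i<n. y i) \<le> (\<Sum>i<n. x i)" by (simp add: sum_subtractf)
  \<comment> \<open>Equality forces each nonnegative term \<open>(x i - y i) - y i * g i\<close> to
    vanish, and \<open>ln z = z - 1\<close> holds only at \<open>z = 1\<close>.\<close>
  assume "(\<Sum>i<n. y i) = (\<Sum>i<n. x i)"
  hence "(\<Sum>i<n. (x i - y i) - y i * g i) \<le> 0"
    using nonneg by (simp add: sum_subtractf)
  moreover have "(\<Sum>i<n. (x i - y i) - y i * g i) \<ge> 0"
    by (intro sum_nonneg) (use le in auto)
  ultimately have z: "(\<Sum>i<n. (x i - y i) - y i * g i) = 0" by simp
  show "\<forall>i<n. x i = y i"
  proof (intro allI impI)
    fix i assume i: "i < n"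
    have "(x i - y i) - y i * g i = 0"
      using sum_nonneg_0[OF _ _ z, of i] le i by simp
    hence "ln (x i / y i) = x i / y i - 1"
      using pos[OF i] by (simp add: g_def field_simps)
    from ln_eq_minus_one[OF _ this] show "x i = y i" using pos[OF i] by simp
  qed
qed

section \<open>Comparison with the reciprocals of the Sylvester sequence\<close>

lemma sum_lessThan_add:
  fixes f :: "nat \<Rightarrow> 'a::comm_monoid_add"
  shows "(\<Sum>i<l + m. f i) = (\<Sum>i<l. f i) + (\<Sum>i<m. f (l + i))"
  by (induction m) (auto simp: add.assoc)

lemma prod_lessThan_add:
  fixes f :: "nat \<Rightarrow> 'a::comm_monoid_mult"
  shows "(\<Prod>i<l + m. f i) = (\<Prod>i<l. f i) * (\<Prod>i<m. f (l + i))"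
  by (induction m) (auto simp: mult.assoc)

text \<open>Strong induction. If the sum of the \<open>b i\<close> is not smaller already, the last
  hypothesis bounds their product by that of the reciprocals \<open>1 / s i\<close>. Cutting where
  the ratio \<open>F\<close> of partial products is maximal leaves a head for the induction
  hypothesis and a tail whose partial products are at most those of the reciprocals, so that
  \<open>sum_le_of_partial_prod_le\<close> compares the sums.\<close>

lemma sum_le_sylvester_seq:
  fixes b :: "nat \<Rightarrow> real"
  assumes pos: "\<And>i. i < k \<Longrightarrow> b i > 0"
    and dec: "\<And>i. Suc i < k \<Longrightarrow> b (Suc i) \<le> b i"
    and prods: "\<And>j. j \<le> k \<Longrightarrow> (\<Prod>i<j. b i) \<le> 1 - (\<Sum>i<j. b i)"
  shows "(\<Sum>i<k. b i) \<le> (\<Sum>i<k. 1 / real (sylvester (Suc i))) \<and>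
    ((\<Sum>i<k. b i) = (\<Sum>i<k. 1 / real (sylvester (Suc i))) \<longrightarrow>
      (\<forall>i<k. b i = 1 / real (sylvester (Suc i))))"
  using assms
proof (induction k rule: less_induct)
  case (less k)
  define s where "s i = real (sylvester (Suc i))" for i
  have s: "s i > 0" for i unfolding s_def using sylvester_pos by simp
  show ?case
  proof (cases "k = 0 \<or> (\<Sum>i<k. b i) < (\<Sum>i<k. 1 / s i)")
    case True
    thus ?thesis by (auto simp: s_def)
  next
    case False
    hence "k > 0" and ge: "(\<Sum>i<k. b i) \<ge> (\<Sum>i<k. 1 / s i)" by auto
    define F where "F j = (\<Prod>i<j. b i * s i)" for j
    have F_pos: "F j > 0" if "j \<le> k" for j
      unfolding F_def using that less.prems(1) s by (intro prod_pos) auto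
    have "(\<Prod>i<k. b i) \<le> 1 / (\<Prod>i<k. s i)"
      using less.prems(3)[of k] ge sum_inverse_sylvester[of k] by (simp add: s_def)
    hence Fk: "F k \<le> F 0"
      using s by (simp add: F_def prod.distrib field_simps prod_pos)
    have "finite (F ` {..<k})" "F ` {..<k} \<noteq> {}" using \<open>k > 0\<close> by auto
    from Max_in[OF this] obtain l where l: "l < k" "F l = Max (F ` {..<k})" by auto
    have F_le: "F j \<le> F l" if "j \<le> k" for j
    proof -
      have *: "F j \<le> F l" if "j < k" for j using l(2) that by simp
      show ?thesis
      proof (cases "j = k")
        case True
        thus ?thesis using Fk *[of 0] \<open>k > 0\<close> by simp
      qed (use that * in simp)
    qed
    define m where "m = k - l"
    have k: "k = l + m" using l m_def by simp
    have IH: "(\<Sum>i<l. b i) \<le> (\<Sum>i<l. 1 / s i)"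
      "(\<Sum>i<l. b i) = (\<Sum>i<l. 1 / s i) \<longrightarrow> (\<forall>i<l. b i = 1 / s i)"
      using less.IH[of l] less.prems l(1) by (auto simp: s_def)
    have block: "(\<Prod>i<j. b (l + i)) \<le> (\<Prod>i<j. 1 / s (l + i))" if "j \<le> m" for j
    proof -
      have "F (l + j) = F l * (\<Prod>i<j. b (l + i) * s (l + i))"
        unfolding F_def by (rule prod_lessThan_add)
      moreover have "F (l + j) \<le> F l" using F_le that k by simp
      ultimately have "(\<Prod>i<j. b (l + i) * s (l + i)) \<le> 1"
        using F_pos[of l] l by simp
      thus ?thesis
        using s by (simp add: prod.distrib prod_dividef field_simps prod_pos)
    qed
    have b1: "(\<Sum>i<m. b (l + i)) \<le> (\<Sum>i<m. 1 / s (l + i))"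
      by (rule sum_le_of_partial_prod_le) (use block s less.prems k in auto)
    have b2: "\<forall>i<m. 1 / s (l + i) = b (l + i)" if "(\<Sum>i<m. b (l + i)) = (\<Sum>i<m. 1 / s (l + i))"
      by (rule sum_le_of_partial_prod_le(2)[OF _ _ _ _ that]) (use block s less.prems k in auto)
    have split: "(\<Sum>i<k. b i) = (\<Sum>i<l. b i) + (\<Sum>i<m. b (l + i))"
      "(\<Sum>i<k. 1 / s i) = (\<Sum>i<l. 1 / s i) + (\<Sum>i<m. 1 / s (l + i))"
      unfolding k by (rule sum_lessThan_add)+
    have "(\<Sum>i<k. b i) \<le> (\<Sum>i<k. 1 / s i)" using split IH b1 by simp
    moreover have "\<forall>i<k. b i = 1 / s i" if eq: "(\<Sum>i<k. b i) = (\<Sum>i<k. 1 / s i)"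
    proof (intro allI impI)
      fix i assume i: "i < k"
      have 1: "(\<Sum>i<l. b i) = (\<Sum>i<l. 1 / s i)" "(\<Sum>i<m. b (l + i)) = (\<Sum>i<m. 1 / s (l + i))"
        using eq split IH(1) b1 by linarith+
      show "b i = 1 / s i"
      proof (cases "i < l")
        case False
        thus ?thesis using b2[OF 1(2)] i k by (metis add_diff_inverse_nat nat_add_left_cancel_less)
      qed (use 1 IH in auto)
    qed
    ultimately show ?thesis unfolding s_def by blast
  qed
qed

text \<open>Sorting \<open>J\<close> by decreasing \<open>\<beta>\<close> reduces this to sequences:
  the initial segments of the sorted order are among the subsets \<open>K\<close>.\<close>

lemma sum_le_sylvester:
  fixes \<beta> :: "'a \<Rightarrow> real"
  assumes fin: "finite J"
    and pos: "\<And>u. u \<in> J \<Longrightarrow> \<beta> u > 0"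
    and prods: "\<And>K. K \<subseteq> J \<Longrightarrow> prod \<beta> K \<le> 1 - sum \<beta> K"
  shows "sum \<beta> J \<le> 1 - 1 / (real (sylvester (Suc (card J))) - 1)"
    and "sum \<beta> J = 1 - 1 / (real (sylvester (Suc (card J))) - 1) \<Longrightarrow>
      \<exists>e. bij_betw e {..<card J} J \<and> (\<forall>i<card J. \<beta> (e i) = 1 / real (sylvester (Suc i)))"
proof -
  obtain xs where xs: "set xs = J" "distinct xs"
    using finite_distinct_list[OF fin] by auto
  define ys where "ys = sort_key (\<lambda>u. - \<beta> u) xs"
  have ys: "set ys = J" "distinct ys" "length ys = card J"
    using xs distinct_card[OF xs(2)] by (simp_all add: ys_def)
  define e where "e i = ys ! i" for i
  have bij: "bij_betw e {..<card J} J"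
    using bij_betw_nth[OF ys(2) _ ys(1)[symmetric], of "{..<card J}"] ys(3)
    by (simp add: e_def[abs_def])
  have e: "e i \<in> J" if "i < card J" for i using that bij by (auto simp: bij_betw_def)
  have srt: "sorted (map (\<lambda>u. - \<beta> u) ys)" unfolding ys_def by simp
  have dec: "\<beta> (e (Suc i)) \<le> \<beta> (e i)" if "Suc i < card J" for i
    using sorted_nth_mono[OF srt, of i "Suc i"] that ys by (auto simp: e_def)
  have pr: "(\<Prod>i<j. \<beta> (e i)) \<le> 1 - (\<Sum>i<j. \<beta> (e i))" if "j \<le> card J" for j
  proof -
    have inj: "inj_on e {..<j}" using bij that by (auto simp: bij_betw_def intro: inj_on_subset)
    have "e ` {..<j} \<subseteq> J" using e that by auto
    from prods[OF this] show ?thesis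
      by (simp add: prod.reindex[OF inj] sum.reindex[OF inj])
  qed
  have sumJ: "sum \<beta> J = (\<Sum>i<card J. \<beta> (e i))"
    using sum.reindex_bij_betw[OF bij, of \<beta>] by simp
  have main: "(\<Sum>i<card J. \<beta> (e i)) \<le> (\<Sum>i<card J. 1 / real (sylvester (Suc i))) \<and>
    ((\<Sum>i<card J. \<beta> (e i)) = (\<Sum>i<card J. 1 / real (sylvester (Suc i))) \<longrightarrow>
      (\<forall>i<card J. \<beta> (e i) = 1 / real (sylvester (Suc i))))"
    by (rule sum_le_sylvester_seq) (use pos e dec pr in auto)
  show "sum \<beta> J \<le> 1 - 1 / (real (sylvester (Suc (card J))) - 1)"
    using main sumJ sum_inverse_sylvester' by metis
  show "\<exists>e. bij_betw e {..<card J} J \<and> (\<forall>i<card J. \<beta> (e i) = 1 / real (sylvester (Suc i)))"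
    if "sum \<beta> J = 1 - 1 / (real (sylvester (Suc (card J))) - 1)"
    using main bij that sumJ sum_inverse_sylvester' by metis
qed

section \<open>Integer linear forms\<close>

text \<open>A discrete Minkowski theorem on linear forms. The vectors \<open>(D n\<^sub>i - b\<^sub>i t)\<^sub>i\<close> with
  \<open>t = \<Sum> n\<^sub>i\<close> form a sublattice of index at most \<open>(D - \<Sum> b\<^sub>i) D\<^bsup>|J| - 1\<^esup>\<close>, so two points of the
  box \<open>\<Prod> {0..<b\<^sub>i}\<close> differ by one of them.\<close>
lemma integer_linear_forms:
  fixes b :: "'a \<Rightarrow> int" and D :: int
  assumes fin: "finite J" and J: "J \<noteq> {}"
    and b: "\<And>i. i \<in> J \<Longrightarrow> b i > 0"
    and s: "sum b J < D"
    and big: "(D - sum b J) * D ^ (card J - 1) < prod b J"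
  obtains n t where "t \<ge> 1" "(\<Sum>i\<in>J. n i) = t" "\<And>i. i \<in> J \<Longrightarrow> \<bar>D * n i - b i * t\<bar> < b i"
proof -
  define s where "s = D - sum b J"
  have s0: "s > 0" using s by (simp add: s_def)
  have "sum b J > 0" using b fin J by (intro sum_pos) auto
  hence D0: "D > 0" using s by simp
  obtain i0 where i0: "i0 \<in> J" using J by auto
  define Y where "Y = PiE J (\<lambda>i. {0..<b i})"
  define Z where "Z = {0..<s} \<times> PiE (J - {i0}) (\<lambda>_. {0..<D})"
  \<comment> \<open>Equal labels make \<open>sum d J\<close> equal to \<open>s * \<tau>\<close> and
    \<open>d i + b i * \<tau>\<close> divisible by \<open>D\<close> for
    \<open>i \<noteq> i0\<close>. The coordinate \<open>i0\<close> is left out of the label, since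
    its divisibility follows from the total \<open>D * \<tau>\<close>.\<close>
  define \<Phi> where "\<Phi> y = (sum y J mod s,
      restrict (\<lambda>i. (y i + b i * (sum y J div s)) mod D) (J - {i0}))" for y :: "'a \<Rightarrow> int"
  have "finite Z" unfolding Z_def using fin by (auto intro: finite_PiE)
  have "int (card Y) = prod b J"
    unfolding Y_def using fin b by (simp add: card_PiE) (intro prod.cong, auto simp: less_imp_le)
  moreover have "int (card Z) = s * D ^ (card J - 1)"
    unfolding Z_def using fin D0 s0 i0 by (simp add: card_cartesian_product card_PiE)
  ultimately have "card Z < card Y" using big unfolding s_def by linarith
  moreover have "\<Phi> ` Y \<subseteq> Z"
    unfolding \<Phi>_def Z_def using s0 D0
    by (intro image_subsetI SigmaI restrict_PiE_iff[THEN iffD2] ballI) simp_all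
  ultimately have "\<not> inj_on \<Phi> Y"
    using \<open>finite Z\<close> by (metis card_inj_on_le leD)
  then obtain y y' where y: "y \<in> Y" "y' \<in> Y" "\<Phi> y = \<Phi> y'" "y \<noteq> y'"
    unfolding inj_on_def by blast
  define \<tau> where "\<tau> = sum y J div s - sum y' J div s"
  define d where "d i = y i - y' i" for i
  have "sum y J mod s = sum y' J mod s" using y(3) by (simp add: \<Phi>_def)
  hence sumd: "sum d J = s * \<tau>"
    unfolding d_def \<tau>_def sum_subtractf right_diff_distrib
    using mult_div_mod_eq[of s "sum y J"] mult_div_mod_eq[of s "sum y' J"] by linarith
  have dvd1: "D dvd d i + b i * \<tau>" if "i \<in> J - {i0}" for i
  proof -
    have "(y i + b i * (sum y J div s)) mod D = (y' i + b i * (sum y' J div s)) mod D"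
      using y(3) that unfolding \<Phi>_def prod.inject by (metis (no_types, lifting) restrict_apply')
    hence "D dvd (y i + b i * (sum y J div s)) - (y' i + b i * (sum y' J div s))"
      by (simp add: mod_eq_dvd_iff)
    thus ?thesis by (simp add: d_def \<tau>_def algebra_simps)
  qed
  have tot: "(\<Sum>i\<in>J. d i + b i * \<tau>) = D * \<tau>"
  proof -
    have "(\<Sum>i\<in>J. d i + b i * \<tau>) = s * \<tau> + sum b J * \<tau>"
      by (simp only: sum.distrib sumd sum_distrib_right)
    thus ?thesis by (simp add: s_def algebra_simps)
  qed
  have rm: "(\<Sum>i\<in>J. d i + b i * \<tau>) = (d i0 + b i0 * \<tau>) + (\<Sum>i\<in>J - {i0}. d i + b i * \<tau>)"
    using fin i0 by (rule sum.remove)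
  have "D dvd (\<Sum>i\<in>J - {i0}. d i + b i * \<tau>)" using dvd1 by (intro dvd_sum) auto
  moreover have "D dvd (d i0 + b i0 * \<tau>) + (\<Sum>i\<in>J - {i0}. d i + b i * \<tau>)"
    unfolding rm[symmetric] tot by (rule dvd_triv_left)
  ultimately have "D dvd d i0 + b i0 * \<tau>"
    by (simp only: dvd_add_left_iff)
  with dvd1 have dvd: "D dvd d i + b i * \<tau>" if "i \<in> J" for i using that by blast
  define n where "n i = (d i + b i * \<tau>) div D" for i
  have n: "D * n i = d i + b i * \<tau>" if "i \<in> J" for i using dvd[OF that] by (simp add: n_def)
  have "D * sum n J = D * \<tau>"
    unfolding tot[symmetric] sum_distrib_left by (rule sum.cong) (simp_all add: n)
  hence sumn: "sum n J = \<tau>" using D0 by simp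
  have dlt: "\<bar>d i\<bar> < b i" if "i \<in> J" for i
  proof -
    have "y i \<in> {0..<b i}" "y' i \<in> {0..<b i}" using y that unfolding Y_def by auto
    thus ?thesis by (auto simp: d_def)
  qed
  have bD: "b i < D" if "i \<in> J" for i
    using member_le_sum[of i J b] that b fin s by (force intro: less_imp_le)
  \<comment> \<open>Otherwise \<open>D\<close> divides every \<open>d i\<close>, and
    \<open>\<bar>d i\<bar> < b i < D\<close> gives \<open>y = y'\<close>.\<close>
  have "\<tau> \<noteq> 0"
  proof
    assume "\<tau> = 0"
    have "y i = y' i" if "i \<in> J" for i
    proof -
      have "D dvd d i" using dvd[OF that] \<open>\<tau> = 0\<close> by simp
      hence "d i = 0"
        using dlt[OF that] bD[OF that] D0 dvd_imp_le_int[of "d i" D] by linarith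
      thus ?thesis by (simp add: d_def)
    qed
    hence "y = y'" using y unfolding Y_def by (intro PiE_ext[of y J _ y']) auto
    thus False using y(4) by simp
  qed
  hence "\<tau> \<ge> 1 \<or> - \<tau> \<ge> 1" by linarith
  thus thesis
  proof
    assume "\<tau> \<ge> 1"
    thus thesis using that[of \<tau> n] sumn n dlt by auto
  next
    assume "- \<tau> \<ge> 1"
    thus thesis using that[of "- \<tau>" "\<lambda>i. - n i"] sumn n dlt by (auto simp: sum_negf)
  qed
qed

section \<open>Segments in lattice-free polytopes\<close>

lemma integral_points_add:
  "x \<in> integral_points \<Longrightarrow> y \<in> integral_points \<Longrightarrow> x + y \<in> integral_points"
  by (auto simp: integral_points_def)

lemma integral_points_diff:
  "x \<in> integral_points \<Longrightarrow> y \<in> integral_points \<Longrightarrow> x - y \<in> integral_points"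
  by (auto simp: integral_points_def)

lemma integral_points_scaleR:
  "x \<in> integral_points \<Longrightarrow> c \<in> \<int> \<Longrightarrow> c *\<^sub>R x \<in> integral_points"
  by (auto simp: integral_points_def)

lemma integral_points_sum:
  "(\<And>i. i \<in> A \<Longrightarrow> f i \<in> integral_points) \<Longrightarrow> sum f A \<in> integral_points"
  by (auto simp: integral_points_def)

lemma finite_bounded_integral_points:
  fixes S :: "(real ^ 'n) set"
  assumes "bounded S"
  shows "finite (S \<inter> integral_points)"
proof -
  obtain B where B: "\<And>x. x \<in> S \<Longrightarrow> norm x \<le> B"
    using assms by (auto simp: bounded_iff)
  let ?F = "PiE (UNIV :: 'n set) (\<lambda>_. {- \<lceil>B\<rceil>..\<lceil>B\<rceil>})"
  have "S \<inter> integral_points \<subseteq> (\<lambda>f. \<chi> i. real_of_int (f i)) ` ?F"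
  proof
    fix x assume x: "x \<in> S \<inter> integral_points"
    have fl: "real_of_int \<lfloor>x $ i\<rfloor> = x $ i" for i
      using x by (auto simp: integral_points_def elim!: Ints_cases)
    have "\<bar>x $ i\<bar> \<le> B" for i using B[of x] x component_le_norm_cart[of x i] by force
    hence "- B \<le> x $ i \<and> x $ i \<le> B" for i by (meson abs_le_iff minus_le_iff)
    hence "(\<lambda>i. \<lfloor>x $ i\<rfloor>) \<in> ?F"
      by (auto simp: PiE_iff) (smt (verit) ceiling_le_iff fl le_of_int_ceiling of_int_le_iff of_int_minus)+
    moreover have "x = (\<chi> i. real_of_int \<lfloor>x $ i\<rfloor>)" by (simp add: vec_eq_iff fl)
    ultimately show "x \<in> (\<lambda>f. \<chi> i. real_of_int (f i)) ` ?F"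
      by (intro image_eqI[where x="\<lambda>i. \<lfloor>x $ i\<rfloor>"]) auto
  qed
  moreover have "finite ?F" by (intro finite_PiE) auto
  ultimately show ?thesis by (meson finite_imageI finite_subset)
qed

text \<open>The interior of \<open>P + \<real> w\<close> stands for the interior of the projection of \<open>P\<close> along \<open>w\<close>.\<close>
locale lattice_free_segment =
  fixes P V :: "(real ^ 'n) set" and p w x :: "real ^ 'n" and l :: real
  assumes P_hull: "P = convex hull V"
    and V: "finite V" "V \<subseteq> integral_points" "p \<in> V"
    and full: "affine hull P = UNIV"
    and free: "interior P \<inter> integral_points = {}"
    and w: "w \<in> integral_points" "w \<noteq> 0"
    and l: "l > 0" "p + l *\<^sub>R w \<in> P"
    and x: "x \<in> integral_points" "x \<in> interior {q + t *\<^sub>R w | q t. q \<in> P}"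
begin

section \<open>Minimal simplices representing the projected lattice point\<close>

lemma convex_P: "convex P"
  by (simp add: P_hull)

lemma V_subset: "V \<subseteq> P"
  by (simp add: P_hull hull_subset)

text \<open>Modulo \<open>w\<close>, \<open>x\<close> is a strictly positive convex combination of
  \<open>I\<close>. Requiring \<open>p \<in> I\<close> gives the fibres of \<open>P\<close> over
  such combinations positive length, because the long segment starts at \<open>p\<close>.\<close>

definition represents :: "(real ^ 'n) set \<Rightarrow> bool" where
  "represents I \<longleftrightarrow> I \<subseteq> V \<and> p \<in> I \<and>
     (\<exists>\<alpha> c. (\<forall>u\<in>I. \<alpha> u > 0) \<and> sum \<alpha> I = 1 \<and> x = (\<Sum>u\<in>I. \<alpha> u *\<^sub>R u) + c *\<^sub>R w)"

lemma representsI: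
  assumes "A \<subseteq> V" "p \<in> A" "\<alpha> p > 0" "\<And>u. u \<in> A \<Longrightarrow> \<alpha> u \<ge> 0" "sum \<alpha> A = 1"
    and "x = (\<Sum>u\<in>A. \<alpha> u *\<^sub>R u) + c *\<^sub>R w"
  shows "represents {u \<in> A. \<alpha> u > 0}"
proof -
  have fin: "finite A" using assms(1) V(1) by (rule finite_subset)
  have "sum \<alpha> {u \<in> A. \<alpha> u > 0} = sum \<alpha> A"
    using assms(4) fin by (intro sum.mono_neutral_left) (auto simp: order.order_iff_strict)
  moreover have "(\<Sum>u | u \<in> A \<and> \<alpha> u > 0. \<alpha> u *\<^sub>R u) = (\<Sum>u\<in>A. \<alpha> u *\<^sub>R u)"
    using assms(4) fin by (intro sum.mono_neutral_left) (auto simp: order.order_iff_strict)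
  ultimately show ?thesis
    unfolding represents_def using assms by (auto intro!: exI[of _ \<alpha>] exI[of _ c])
qed

text \<open>Moving \<open>x\<close> slightly away from \<open>p\<close> stays within the translates
  of \<open>P\<close> along \<open>w\<close>. Writing the point reached as a convex combination of
  \<open>V\<close> modulo \<open>w\<close> and averaging it with \<open>p\<close> recovers
  \<open>x\<close> with positive weight on \<open>p\<close>.\<close>

lemma ex_represents: "\<exists>I. represents I"
proof -
  obtain e where e: "e > 0" "ball x e \<subseteq> {q + t *\<^sub>R w | q t. q \<in> P}"
    using x(2) by (auto simp: mem_interior)
  \<comment> \<open>The summand 1 keeps the denominator positive even when
    \<open>x = p\<close>.\<close>
  define \<delta> where "\<delta> = e / (2 * (norm (x - p) + 1))"
  have \<delta>: "\<delta> > 0" using e by (simp add: \<delta>_def add_nonneg_pos)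
  have "\<delta> * norm (x - p) < e"
  proof -
    have "norm (x - p) < 2 * (norm (x - p) + 1)" by (smt (verit) norm_ge_zero)
    thus ?thesis using e(1) by (simp add: \<delta>_def divide_less_eq mult.commute add_nonneg_pos)
  qed
  hence "x + \<delta> *\<^sub>R (x - p) \<in> ball x e" using \<delta> by (simp add: dist_norm)
  then obtain q t where q: "q \<in> P" "x + \<delta> *\<^sub>R (x - p) = q + t *\<^sub>R w" using e by blast
  then obtain \<kappa> where la: "\<And>v. v \<in> V \<Longrightarrow> \<kappa> v \<ge> 0" "sum \<kappa> V = 1" "(\<Sum>v\<in>V. \<kappa> v *\<^sub>R v) = q"
    unfolding P_hull convex_hull_finite[OF V(1)] by blast
  define \<alpha> where "\<alpha> v = (\<kappa> v + (if v = p then \<delta> else 0)) / (1 + \<delta>)" for v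
  have s1: "sum \<alpha> V = 1"
    using la V \<delta> by (simp add: \<alpha>_def sum_divide_distrib[symmetric] sum.distrib)
  have "(\<Sum>v\<in>V. \<alpha> v *\<^sub>R v)
      = (\<Sum>v\<in>V. (1 / (1 + \<delta>)) *\<^sub>R (\<kappa> v *\<^sub>R v + (if v = p then \<delta> *\<^sub>R p else 0)))"
    by (intro sum.cong) (auto simp: \<alpha>_def scaleR_add_left scaleR_add_right add_divide_distrib)
  also have "\<dots> = (1 / (1 + \<delta>)) *\<^sub>R (q + \<delta> *\<^sub>R p)"
    using V la by (simp add: scaleR_sum_right[symmetric] sum.distrib)
  finally have s2: "(\<Sum>v\<in>V. \<alpha> v *\<^sub>R v) = (1 / (1 + \<delta>)) *\<^sub>R (q + \<delta> *\<^sub>R p)" .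
  have "(1 + \<delta>) *\<^sub>R x = q + \<delta> *\<^sub>R p + t *\<^sub>R w"
    using q(2) by (simp add: algebra_simps)
  hence "(1 / (1 + \<delta>)) *\<^sub>R ((1 + \<delta>) *\<^sub>R x) = (1 / (1 + \<delta>)) *\<^sub>R (q + \<delta> *\<^sub>R p + t *\<^sub>R w)"
    by simp
  hence "x = (\<Sum>v\<in>V. \<alpha> v *\<^sub>R v) + (t / (1 + \<delta>)) *\<^sub>R w"
    using \<delta> unfolding s2 by (simp add: scaleR_add_right)
  from representsI[OF _ _ _ _ s1 this] V la \<delta> show ?thesis
    by (auto simp: \<alpha>_def add_nonneg_pos)
qed

text \<open>Minimal cardinality yields affine independence modulo \<open>w\<close>: a dependence
  would allow a point of \<open>I\<close> other than \<open>p\<close> to be dropped.\<close>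

definition I :: "(real ^ 'n) set" where
  "I = arg_min card represents"

lemma represents_I: "represents I"
  unfolding I_def using ex_represents by (metis arg_min_natI)

lemma I_minimal: "represents K \<Longrightarrow> card I \<le> card K"
  unfolding I_def by (rule arg_min_nat_le)

lemma I_subset: "I \<subseteq> V" and p_in_I: "p \<in> I"
  using represents_I by (auto simp: represents_def)

lemma finite_I: "finite I"
  using I_subset V(1) by (rule finite_subset)

lemma I_integral: "u \<in> I \<Longrightarrow> u \<in> integral_points"
  using I_subset V by auto

text \<open>Caratheodory's reduction, choosing the sign of the affine dependence so that the
  coefficient of \<open>p\<close> does not decrease.\<close>
lemma I_independent:
  assumes "sum \<mu> I = 0" "(\<Sum>u\<in>I. \<mu> u *\<^sub>R u) = e *\<^sub>R w"
  shows "\<forall>u\<in>I. \<mu> u = 0"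
proof (rule ccontr)
  assume "\<not> ?thesis"
  hence ex: "\<exists>u\<in>I. \<mu> u \<noteq> 0" by auto
  obtain \<nu> f where \<nu>: "sum \<nu> I = 0" "(\<Sum>u\<in>I. \<nu> u *\<^sub>R u) = f *\<^sub>R w" "\<exists>u\<in>I. \<nu> u \<noteq> 0" "\<nu> p \<ge> 0"
  proof (cases "\<mu> p \<ge> 0")
    case True
    thus ?thesis using assms ex that by blast
  next
    case False
    thus ?thesis using assms ex that[of "\<lambda>u. - \<mu> u" "- e"] by (auto simp: sum_negf)
  qed
  define N where "N = {u \<in> I. \<nu> u < 0}"
  have "N \<noteq> {}"
  proof
    assume "N = {}"
    hence "\<forall>u\<in>I. \<nu> u \<ge> 0" by (auto simp: N_def not_less)
    hence "\<forall>u\<in>I. \<nu> u = 0" using \<nu>(1) finite_I by (simp add: sum_nonneg_eq_0_iff)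
    thus False using \<nu>(3) by auto
  qed
  obtain \<alpha> c where \<alpha>: "\<forall>u\<in>I. \<alpha> u > 0" "sum \<alpha> I = 1" "x = (\<Sum>u\<in>I. \<alpha> u *\<^sub>R u) + c *\<^sub>R w"
    using represents_I unfolding represents_def by blast
  define t where "t = Min ((\<lambda>u. \<alpha> u / (- \<nu> u)) ` N)"
  have finN: "finite N" using finite_I by (simp add: N_def)
  have "t \<in> (\<lambda>u. \<alpha> u / (- \<nu> u)) ` N"
    unfolding t_def using finN \<open>N \<noteq> {}\<close> by (intro Min_in) auto
  then obtain u1 where u1: "u1 \<in> N" "t = \<alpha> u1 / (- \<nu> u1)" by auto
  have tle: "t \<le> \<alpha> u / (- \<nu> u)" if "u \<in> N" for u
    unfolding t_def using finN that by auto
  have t0: "t > 0" using u1 \<alpha>(1) by (auto simp: N_def divide_pos_neg)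
  define \<gamma> where "\<gamma> u = \<alpha> u + t * \<nu> u" for u
  have g0: "\<gamma> u \<ge> 0" if "u \<in> I" for u
  proof (cases "u \<in> N")
    case True
    hence "\<nu> u < 0" by (simp add: N_def)
    with tle[OF True] show ?thesis by (simp add: \<gamma>_def field_simps)
  next
    case False
    hence "\<nu> u \<ge> 0" using that by (simp add: N_def)
    thus ?thesis using \<alpha>(1) t0 that by (simp add: \<gamma>_def less_imp_le)
  qed
  have gp: "\<gamma> p > 0" using \<alpha>(1) p_in_I t0 \<nu>(4) by (simp add: \<gamma>_def add_pos_nonneg)
  have gs: "sum \<gamma> I = 1"
    using \<alpha>(2) \<nu>(1) by (simp add: \<gamma>_def sum.distrib sum_distrib_left[symmetric])
  have "(\<Sum>u\<in>I. \<gamma> u *\<^sub>R u) = (\<Sum>u\<in>I. \<alpha> u *\<^sub>R u) + t *\<^sub>R (\<Sum>u\<in>I. \<nu> u *\<^sub>R u)"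
    by (simp add: \<gamma>_def scaleR_add_left sum.distrib scaleR_sum_right)
  hence "x = (\<Sum>u\<in>I. \<gamma> u *\<^sub>R u) + (c - t * f) *\<^sub>R w"
    using \<alpha>(3) \<nu>(2) by (simp add: algebra_simps)
  from representsI[OF I_subset p_in_I gp g0 gs this] have "represents {u \<in> I. \<gamma> u > 0}" .
  hence "card I \<le> card {u \<in> I. \<gamma> u > 0}" by (rule I_minimal)
  moreover have "{u \<in> I. \<gamma> u > 0} \<subset> I"
  proof -
    have "u1 \<in> I" "\<nu> u1 < 0" using u1 by (auto simp: N_def)
    moreover have "\<gamma> u1 = 0" using u1(2) \<open>\<nu> u1 < 0\<close> by (simp add: \<gamma>_def)
    ultimately show ?thesis by force
  qed
  ultimately show False using psubset_card_mono[OF finite_I, of "{u \<in> I. \<gamma> u > 0}"] by linarith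
qed

text \<open>Giving \<open>p\<close> the negated sum of the other coefficients turns a linear
  relation among the differences into an affine one.\<close>

lemma I_independent_diff:
  assumes "(\<Sum>u\<in>I - {p}. \<mu> u *\<^sub>R (u - p)) = e *\<^sub>R w"
  shows "\<forall>u\<in>I - {p}. \<mu> u = 0"
proof -
  define \<nu> where "\<nu> u = (if u = p then - sum \<mu> (I - {p}) else \<mu> u)" for u
  have "sum \<nu> I = \<nu> p + sum \<nu> (I - {p})"
    using finite_I p_in_I by (rule sum.remove)
  also have "sum \<nu> (I - {p}) = sum \<mu> (I - {p})" by (intro sum.cong) (auto simp: \<nu>_def)
  finally have s: "sum \<nu> I = 0" by (simp add: \<nu>_def)
  have "(\<Sum>u\<in>I. \<nu> u *\<^sub>R u) = \<nu> p *\<^sub>R p + (\<Sum>u\<in>I - {p}. \<nu> u *\<^sub>R u)"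
    using finite_I p_in_I by (rule sum.remove)
  also have "(\<Sum>u\<in>I - {p}. \<nu> u *\<^sub>R u) = (\<Sum>u\<in>I - {p}. \<mu> u *\<^sub>R u)"
    by (intro sum.cong) (auto simp: \<nu>_def)
  finally have "(\<Sum>u\<in>I. \<nu> u *\<^sub>R u) = e *\<^sub>R w"
    using assms by (simp add: \<nu>_def scaleR_diff_right sum_subtractf scaleR_sum_left)
  from I_independent[OF s this] have "\<forall>u\<in>I - {p}. \<nu> u = 0" by blast
  thus ?thesis by (simp add: \<nu>_def)
qed

text \<open>The independence of these vectors bounds \<open>card I\<close> by the dimension; when
  \<open>card I\<close> equals the dimension they span the whole space.\<close>

definition directions :: "(real ^ 'n) set" where
  "directions = insert w ((\<lambda>u. u - p) ` (I - {p}))"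

lemma w_notin: "w \<notin> (\<lambda>u. u - p) ` (I - {p})"
proof
  assume "w \<in> (\<lambda>u. u - p) ` (I - {p})"
  then obtain v where v: "v \<in> I - {p}" "w = v - p" by auto
  have "(\<Sum>u\<in>I - {p}. (if u = v then 1 else 0) *\<^sub>R (u - p))
      = (\<Sum>u\<in>I - {p}. if u = v then v - p else 0)"
    by (intro sum.cong) auto
  also have "\<dots> = 1 *\<^sub>R w" using v finite_I by simp
  finally have "(\<Sum>u\<in>I - {p}. (if u = v then 1 else 0) *\<^sub>R (u - p)) = 1 *\<^sub>R w" .
  from I_independent_diff[OF this] have "(if v = v then 1 else 0) = (0::real)" using v(1) by (rule bspec)
  thus False by simp
qed

lemma sum_directions:
  "(\<Sum>v\<in>directions. c v *\<^sub>R v) = c w *\<^sub>R w + (\<Sum>u\<in>I - {p}. c (u - p) *\<^sub>R (u - p))"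
proof -
  have "inj_on (\<lambda>u. u - p) (I - {p})" by (auto simp: inj_on_def)
  thus ?thesis
    unfolding directions_def using w_notin finite_I by (simp add: sum.reindex)
qed

lemma independent_directions: "independent directions"
  unfolding independent_explicit
proof (intro conjI allI impI ballI)
  show "finite directions" using finite_I by (simp add: directions_def)
  fix c v assume 0: "(\<Sum>v\<in>directions. c v *\<^sub>R v) = 0" and v: "v \<in> directions"
  have eq: "(\<Sum>u\<in>I - {p}. c (u - p) *\<^sub>R (u - p)) = (- c w) *\<^sub>R w"
    using minus_unique[OF 0[unfolded sum_directions]] by simp
  from I_independent_diff[OF this] have z: "\<forall>u\<in>I - {p}. c (u - p) = 0" .
  have "(- c w) *\<^sub>R w = 0" unfolding eq[symmetric] using z by (intro sum.neutral) auto
  hence "c w = 0" using w by simp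
  thus "c v = 0" using z v by (auto simp: directions_def)
qed

lemma card_directions: "card directions = card I"
proof -
  have "inj_on (\<lambda>u. u - p) (I - {p})" by (auto simp: inj_on_def)
  hence "card ((\<lambda>u. u - p) ` (I - {p})) = card I - 1"
    using finite_I p_in_I by (simp add: card_image)
  moreover have "card I > 0" using finite_I p_in_I by (auto simp: card_gt_0_iff)
  ultimately show ?thesis
    unfolding directions_def using w_notin finite_I by simp
qed

lemma card_I_le: "card I \<le> CARD('n)"
  using independent_bound[OF independent_directions] card_directions by simp

text \<open>A supporting hyperplane of \<open>P\<close> at such a point would contain \<open>I\<close> and be parallel to \<open>w\<close>,
  hence it would support the projection of \<open>P\<close> at \<open>x\<close>.\<close>
lemma interior_combination:
  assumes \<beta>: "\<And>u. u \<in> I \<Longrightarrow> \<beta> u > 0" "sum \<beta> I = 1" and \<tau>: "0 < \<tau>" "\<tau> < \<beta> p * l"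
  shows "(\<Sum>u\<in>I. \<beta> u *\<^sub>R u) + \<tau> *\<^sub>R w \<in> interior P"
proof (rule ccontr)
  define y where "y = (\<Sum>u\<in>I. \<beta> u *\<^sub>R u) + \<tau> *\<^sub>R w"
  assume "\<not> ?thesis"
  hence not: "y \<notin> rel_interior P" using rel_interior_interior[OF full] by (simp add: y_def)
  \<comment> \<open>Only \<open>p\<close> is moved along \<open>w\<close>. Its weight
    \<open>\<beta> p\<close> turns the shift \<open>\<tau> / \<beta> p < l\<close> into
    \<open>\<tau>\<close>, so \<open>y\<close> becomes a positive combination of points of
    \<open>P\<close>.\<close>
  define b where "b u = (if u = p then p + (\<tau> / \<beta> p) *\<^sub>R w else u)" for u
  have bp: "\<beta> p > 0" using \<beta> p_in_I by auto
  have IP: "I \<subseteq> P" using I_subset V_subset by auto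
  have bP: "b u \<in> P" if "u \<in> I" for u
  proof (cases "u = p")
    case True
    have "p + (\<tau> / \<beta> p) *\<^sub>R w = (1 - \<tau> / (\<beta> p * l)) *\<^sub>R p + (\<tau> / (\<beta> p * l)) *\<^sub>R (p + l *\<^sub>R w)"
      using l by (simp add: algebra_simps)
    also have "\<dots> \<in> P"
      using convex_P p_in_I IP l \<tau> bp by (intro convexD) (auto simp: divide_simps)
    finally show ?thesis using True by (simp add: b_def)
  qed (use that IP in \<open>auto simp: b_def\<close>)
  have "(\<Sum>u\<in>I. \<beta> u *\<^sub>R b u) = \<beta> p *\<^sub>R b p + (\<Sum>u\<in>I - {p}. \<beta> u *\<^sub>R b u)"
    using finite_I p_in_I by (rule sum.remove)
  also have "(\<Sum>u\<in>I - {p}. \<beta> u *\<^sub>R b u) = (\<Sum>u\<in>I - {p}. \<beta> u *\<^sub>R u)"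
    by (intro sum.cong) (auto simp: b_def)
  also have "\<beta> p *\<^sub>R b p = \<beta> p *\<^sub>R p + \<tau> *\<^sub>R w"
    using bp by (simp add: b_def scaleR_add_right)
  also have "\<beta> p *\<^sub>R p + \<tau> *\<^sub>R w + (\<Sum>u\<in>I - {p}. \<beta> u *\<^sub>R u) = y"
    unfolding y_def sum.remove[OF finite_I p_in_I] by simp
  finally have y: "y = (\<Sum>u\<in>I. \<beta> u *\<^sub>R b u)" by simp
  have yP: "y \<in> P"
    unfolding y using \<beta> bP finite_I by (intro convex_sum convex_P) (auto simp: less_imp_le)
  obtain a where a: "a \<noteq> 0" "\<And>z. z \<in> P \<Longrightarrow> a \<bullet> y \<le> a \<bullet> z"
    using supporting_hyperplane_rel_boundary[OF convex_P yP not] by metis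
  have "a \<bullet> y = (\<Sum>u\<in>I. \<beta> u * (a \<bullet> b u))" unfolding y by (simp add: inner_sum_right)
  moreover have "(\<Sum>u\<in>I. \<beta> u * (a \<bullet> y)) = a \<bullet> y"
    using \<beta>(2) by (simp add: sum_distrib_right[symmetric])
  ultimately have "(\<Sum>u\<in>I. \<beta> u * (a \<bullet> b u - a \<bullet> y)) = 0"
    by (simp add: right_diff_distrib sum_subtractf)
  moreover have "\<beta> u * (a \<bullet> b u - a \<bullet> y) \<ge> 0" if "u \<in> I" for u
    using \<beta>(1)[OF that] a(2)[OF bP[OF that]] by simp
  ultimately have "\<forall>u\<in>I. \<beta> u * (a \<bullet> b u - a \<bullet> y) = 0"
    using finite_I by (simp add: sum_nonneg_eq_0_iff)
  hence ab: "a \<bullet> b u = a \<bullet> y" if "u \<in> I" for u using \<beta>(1) that by fastforce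
  \<comment> \<open>Since \<open>0 < \<tau> / \<beta> p < l\<close>, the supporting hyperplane meets
    the segment from \<open>p\<close> to \<open>p + l *\<^sub>R w\<close> in an inner point, so
    \<open>a\<close> is orthogonal to \<open>w\<close>.\<close>
  have p1: "a \<bullet> p + (\<tau> / \<beta> p) * (a \<bullet> w) = a \<bullet> y"
    using ab[OF p_in_I] by (simp add: b_def inner_add_right)
  have p2: "a \<bullet> y \<le> a \<bullet> p" using a(2) p_in_I IP by auto
  have p3: "a \<bullet> y \<le> a \<bullet> p + l * (a \<bullet> w)" using a(2)[OF l(2)] by (simp add: inner_add_right)
  have "(\<tau> / \<beta> p) * (a \<bullet> w) \<le> 0" using p1 p2 by linarith
  hence "a \<bullet> w \<le> 0" using \<tau> bp by (simp add: mult_le_0_iff divide_le_0_iff)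
  moreover have "(l - \<tau> / \<beta> p) * (a \<bullet> w) \<ge> 0" using p1 p3 by (simp add: left_diff_distrib)
  hence "a \<bullet> w \<ge> 0" using \<tau> bp by (auto simp: zero_le_mult_iff divide_simps mult.commute)
  ultimately have aw: "a \<bullet> w = 0" by simp
  have au: "a \<bullet> u = a \<bullet> y" if "u \<in> I" for u
    using ab[OF that] aw by (auto simp: b_def inner_add_right split: if_splits)
  obtain \<alpha> c where \<alpha>: "sum \<alpha> I = 1" "x = (\<Sum>u\<in>I. \<alpha> u *\<^sub>R u) + c *\<^sub>R w"
    using represents_I unfolding represents_def by blast
  have "a \<bullet> x = (\<Sum>u\<in>I. \<alpha> u * (a \<bullet> u))"
    by (subst \<alpha>(2)) (simp add: inner_add_right inner_sum_right aw)
  also have "\<dots> = (\<Sum>u\<in>I. \<alpha> u * (a \<bullet> y))" by (intro sum.cong) (simp_all add: au)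
  also have "\<dots> = a \<bullet> y" using \<alpha>(1) by (simp add: sum_distrib_right[symmetric])
  finally have ax: "a \<bullet> x = a \<bullet> y" .
  obtain e where e: "e > 0" "cball x e \<subseteq> {q + t *\<^sub>R w | q t. q \<in> P}"
    using x(2) by (auto simp: mem_interior_cball)
  \<comment> \<open>A small step from \<open>x\<close> against \<open>a\<close> stays within the
    translates of \<open>P\<close> along \<open>w\<close>, where the inner product with
    \<open>a\<close> is at least \<open>a \<bullet> y = a \<bullet> x\<close>.\<close>
  have "x - (e / norm a) *\<^sub>R a \<in> cball x e" using a e by (simp add: dist_norm)
  then obtain q t where q: "q \<in> P" "x - (e / norm a) *\<^sub>R a = q + t *\<^sub>R w" using e by blast
  have "a \<bullet> (q + t *\<^sub>R w) = a \<bullet> x - (e / norm a) * (a \<bullet> a)"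
    unfolding q(2)[symmetric] by (simp add: inner_diff_right)
  moreover have "a \<bullet> (q + t *\<^sub>R w) = a \<bullet> q" by (simp add: inner_add_right aw)
  moreover have "a \<bullet> q \<ge> a \<bullet> y" using a q by auto
  moreover have "(e / norm a) * (a \<bullet> a) > 0" using a e by simp
  ultimately show False using ax by linarith
qed

text \<open>Barycentric coordinates of the lattice points in the relative interior of the simplex with
  vertices \<open>I\<close>, everything taken modulo \<open>w\<close>.\<close>
definition admissible :: "(real ^ 'n \<Rightarrow> real) \<Rightarrow> bool" where
  "admissible \<beta> \<longleftrightarrow> (\<forall>u\<in>I. \<beta> u > 0) \<and> sum \<beta> I = 1 \<and>
     (\<exists>c. (\<Sum>u\<in>I. \<beta> u *\<^sub>R u) + c *\<^sub>R w \<in> integral_points)"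

text \<open>The fibre over \<open>\<beta>\<close> has a lattice point at an offset
  \<open>\<tau>\<close> in \<open>(0, 1]\<close>; if \<open>\<tau> < \<beta> p * l\<close>, that
  point would be interior to \<open>P\<close>. If \<open>\<beta> p * l = 1\<close>, the offset must
  be 1, and subtracting \<open>w\<close> gives the lattice point at offset 0.\<close>

lemma admissible_le:
  assumes "admissible \<beta>"
  shows "\<beta> p * l \<le> 1"
    and "\<beta> p * l = 1 \<Longrightarrow> (\<Sum>u\<in>I. \<beta> u *\<^sub>R u) \<in> integral_points"
proof -
  from assms obtain c where \<beta>: "\<forall>u\<in>I. \<beta> u > 0" "sum \<beta> I = 1"
    "(\<Sum>u\<in>I. \<beta> u *\<^sub>R u) + c *\<^sub>R w \<in> integral_points"
    unfolding admissible_def by blast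
  have shift: "(\<Sum>u\<in>I. \<beta> u *\<^sub>R u) + (c + of_int m) *\<^sub>R w \<in> integral_points" for m
  proof -
    have "(\<Sum>u\<in>I. \<beta> u *\<^sub>R u) + c *\<^sub>R w + of_int m *\<^sub>R w \<in> integral_points"
      using \<beta>(3) by (rule integral_points_add) (use w in \<open>auto intro: integral_points_scaleR\<close>)
    thus ?thesis by (simp add: algebra_simps)
  qed
  \<comment> \<open>The representative of \<open>c\<close> modulo 1 is taken in
    \<open>(0, 1]\<close> and not in \<open>[0, 1)\<close>, as \<open>interior_combination\<close>
    asks for a positive offset.\<close>
  define \<tau> where "\<tau> = c + of_int (1 - \<lceil>c\<rceil>)"
  have \<tau>: "0 < \<tau>" "\<tau> \<le> 1" unfolding \<tau>_def by linarith+
  have no: "\<not> \<tau> < \<beta> p * l"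
  proof
    assume "\<tau> < \<beta> p * l"
    hence "(\<Sum>u\<in>I. \<beta> u *\<^sub>R u) + \<tau> *\<^sub>R w \<in> interior P"
      using \<beta> \<tau> by (intro interior_combination) auto
    thus False using shift[of "1 - \<lceil>c\<rceil>"] free by (auto simp: \<tau>_def)
  qed
  thus "\<beta> p * l \<le> 1" using \<tau> by linarith
  assume "\<beta> p * l = 1"
  hence "\<tau> = 1" using no \<tau> by linarith
  hence "c = of_int (\<lceil>c\<rceil>)" by (simp add: \<tau>_def)
  hence "c + of_int (- \<lceil>c\<rceil>) = 0" by simp
  thus "(\<Sum>u\<in>I. \<beta> u *\<^sub>R u) \<in> integral_points" using shift[of "- \<lceil>c\<rceil>"] by (simp only:) simp
qed

text \<open>The values \<open>\<beta> p\<close> are bounded by \<open>1 / l\<close>, and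
  \<open>x\<close> supplies a positive one, so some value exceeds half their supremum. The factor 2
  is enough because the competitor built in \<open>prod_le_of_large\<close> has at least twice the
  coordinate at \<open>p\<close>.\<close>

lemma ex_admissible_large: "\<exists>\<beta>. admissible \<beta> \<and> (\<forall>\<gamma>. admissible \<gamma> \<longrightarrow> \<gamma> p < 2 * \<beta> p)"
proof -
  obtain \<alpha> c where \<alpha>: "\<forall>u\<in>I. \<alpha> u > 0" "sum \<alpha> I = 1" "x = (\<Sum>u\<in>I. \<alpha> u *\<^sub>R u) + c *\<^sub>R w"
    using represents_I unfolding represents_def by blast
  hence "admissible \<alpha>" using x(1) unfolding admissible_def by metis
  define S where "S = (\<lambda>\<beta>. \<beta> p) ` {\<beta>. admissible \<beta>}"
  have bdd: "bdd_above S"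
    using admissible_le(1) l(1) unfolding S_def bdd_above_def
    by (intro exI[of _ "1 / l"]) (auto simp: field_simps)
  have \<alpha>S: "\<alpha> p \<in> S" using \<open>admissible \<alpha>\<close> by (auto simp: S_def)
  have "\<alpha> p > 0" using \<alpha> p_in_I by auto
  moreover have "\<alpha> p \<le> Sup S" using bdd \<alpha>S by (rule cSup_upper[rotated])
  ultimately have "Sup S / 2 < Sup S" by simp
  then obtain r where "r \<in> S" "Sup S / 2 < r" using \<alpha>S by (metis less_cSupD empty_iff)
  then obtain \<beta> where \<beta>: "admissible \<beta>" "Sup S / 2 < \<beta> p" by (auto simp: S_def)
  have "\<gamma> p < 2 * \<beta> p" if "admissible \<gamma>" for \<gamma>
    using cSup_upper[OF _ bdd, of "\<gamma> p"] that \<beta>(2) by (auto simp: S_def)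
  thus ?thesis using \<beta>(1) by blast
qed

text \<open>Among the multiples of a lattice point, two have the same fractional coordinates.\<close>
lemma admissible_denominator:
  assumes "admissible \<beta>"
  obtains D :: nat where "D > 0" "\<And>u. u \<in> I \<Longrightarrow> real D * \<beta> u \<in> \<int>"
proof -
  from assms obtain c where \<beta>: "\<forall>u\<in>I. \<beta> u > 0" "sum \<beta> I = 1"
    "(\<Sum>u\<in>I. \<beta> u *\<^sub>R u) + c *\<^sub>R w \<in> integral_points"
    unfolding admissible_def by blast
  \<comment> \<open>The \<open>t\<close>-th multiple of the lattice point, seen from
    \<open>p\<close> and reduced modulo the vectors \<open>u - p\<close> and \<open>w\<close>. All
    these reductions are lattice points in a bounded set.\<close>
  define \<phi> where "\<phi> t = (\<Sum>u\<in>I - {p}. frac (real t * \<beta> u) *\<^sub>R (u - p)) + frac (real t * c) *\<^sub>R w"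
    for t :: nat
  have X: "(\<Sum>u\<in>I - {p}. \<beta> u *\<^sub>R (u - p)) + c *\<^sub>R w \<in> integral_points"
  proof -
    have "(\<Sum>u\<in>I - {p}. \<beta> u *\<^sub>R (u - p)) = (\<Sum>u\<in>I. \<beta> u *\<^sub>R (u - p))"
      using sum.remove[OF finite_I p_in_I, of "\<lambda>u. \<beta> u *\<^sub>R (u - p)"] by simp
    also have "\<dots> = (\<Sum>u\<in>I. \<beta> u *\<^sub>R u) - p"
      using \<beta>(2) by (simp add: scaleR_diff_right sum_subtractf scaleR_sum_left[symmetric])
    finally show ?thesis
      using integral_points_diff[OF \<beta>(3) I_integral[OF p_in_I]] by (simp add: add_diff_eq diff_add_eq)
  qed
  have int: "\<phi> t \<in> integral_points" for t
  proof -
    have "\<phi> t = real t *\<^sub>R ((\<Sum>u\<in>I - {p}. \<beta> u *\<^sub>R (u - p)) + c *\<^sub>R w)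
        - (\<Sum>u\<in>I - {p}. of_int \<lfloor>real t * \<beta> u\<rfloor> *\<^sub>R (u - p)) - of_int \<lfloor>real t * c\<rfloor> *\<^sub>R w"
      by (simp add: \<phi>_def frac_def scaleR_diff_left sum_subtractf scaleR_add_right scaleR_sum_right)
    also have "\<dots> \<in> integral_points"
      by (intro integral_points_diff integral_points_sum integral_points_scaleR[OF X]
          integral_points_scaleR[OF integral_points_diff] integral_points_scaleR[OF w(1)])
        (use I_integral p_in_I in auto)
    finally show ?thesis .
  qed
  have "norm (\<phi> t) \<le> (\<Sum>u\<in>I - {p}. norm (u - p)) + norm w" for t
  proof -
    have "norm (\<phi> t) \<le> (\<Sum>u\<in>I - {p}. norm (frac (real t * \<beta> u) *\<^sub>R (u - p)))
        + norm (frac (real t * c) *\<^sub>R w)"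
      unfolding \<phi>_def by (intro norm_triangle_mono norm_sum order_refl)
    also have "\<dots> \<le> (\<Sum>u\<in>I - {p}. norm (u - p)) + norm w"
      by (intro add_mono sum_mono) (auto simp: frac_lt_1 less_imp_le mult_left_le_one_le)
    finally show ?thesis .
  qed
  hence "bounded (range \<phi>)" by (auto simp: bounded_iff)
  hence "finite (range \<phi> \<inter> integral_points)" by (rule finite_bounded_integral_points)
  moreover have "range \<phi> \<inter> integral_points = range \<phi>" using int by auto
  ultimately have "\<not> inj \<phi>" using finite_imageD[of \<phi> UNIV] by auto
  then obtain s t where st: "\<phi> s = \<phi> t" "s < t"
    unfolding inj_def by (metis linorder_neqE_nat)
  have swap: "c - a = b - d" if "a + b = c + d" for a b c d :: "real ^ 'n"
    using that by (simp add: algebra_simps)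
  have "(\<Sum>u\<in>I - {p}. (frac (real t * \<beta> u) - frac (real s * \<beta> u)) *\<^sub>R (u - p))
      = (frac (real s * c) - frac (real t * c)) *\<^sub>R w"
    unfolding scaleR_diff_left sum_subtractf
    by (rule swap[OF st(1)[unfolded \<phi>_def]])
  from I_independent_diff[OF this]
  have fr: "frac (real t * \<beta> u) = frac (real s * \<beta> u)" if "u \<in> I - {p}" for u using that by auto
  define D where "D = t - s"
  have D1: "real D * \<beta> u \<in> \<int>" if "u \<in> I - {p}" for u
  proof -
    have "real D * \<beta> u = real t * \<beta> u - real s * \<beta> u"
      using st by (simp add: D_def of_nat_diff left_diff_distrib)
    also have "\<dots> = of_int (\<lfloor>real t * \<beta> u\<rfloor> - \<lfloor>real s * \<beta> u\<rfloor>)"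
      using fr[OF that] by (simp add: frac_def)
    finally show ?thesis by simp
  qed
  have "\<beta> p = 1 - sum \<beta> (I - {p})" using sum.remove[OF finite_I p_in_I, of \<beta>] \<beta>(2) by simp
  hence "real D * \<beta> p = real D - (\<Sum>u\<in>I - {p}. real D * \<beta> u)"
    by (simp add: right_diff_distrib sum_distrib_left)
  also have "\<dots> \<in> \<int>" using D1 by (intro Ints_diff Ints_sum) auto
  finally have "real D * \<beta> p \<in> \<int>" .
  with D1 have "\<And>u. u \<in> I \<Longrightarrow> real D * \<beta> u \<in> \<int>" by blast
  moreover have "D > 0" using st by (simp add: D_def)
  ultimately show thesis using that by blast
qed

text \<open>If this failed, the linear forms theorem would give a multiple of the lattice point which,
  reduced modulo the points of \<open>K\<close>, is admissible with at least twice the coefficient at \<open>p\<close>.\<close>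
lemma prod_le_of_large:
  assumes adm: "admissible \<beta>" and large: "\<And>\<gamma>. admissible \<gamma> \<Longrightarrow> \<gamma> p < 2 * \<beta> p"
    and K: "K \<subseteq> I - {p}"
  shows "prod \<beta> K \<le> 1 - sum \<beta> K"
proof (rule ccontr)
  assume "\<not> ?thesis"
  hence gt: "1 - sum \<beta> K < prod \<beta> K" by simp
  from adm obtain c where \<beta>: "\<forall>u\<in>I. \<beta> u > 0" "sum \<beta> I = 1"
    "(\<Sum>u\<in>I. \<beta> u *\<^sub>R u) + c *\<^sub>R w \<in> integral_points"
    unfolding admissible_def by blast
  have finK: "finite K" using K finite_I finite_subset by blast
  have "K \<noteq> {}" using gt by auto
  obtain D where D: "D > 0" "\<And>u. u \<in> I \<Longrightarrow> real D * \<beta> u \<in> \<int>"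
    using admissible_denominator[OF adm] by blast
  define b where "b u = \<lfloor>real D * \<beta> u\<rfloor>" for u
  have b: "real_of_int (b u) = real D * \<beta> u" if "u \<in> I" for u
    using D(2)[OF that] by (auto simp: b_def elim!: Ints_cases)
  have bK: "real_of_int (b u) = real D * \<beta> u" if "u \<in> K" for u using b K that by auto
  have b0: "b u > 0" if "u \<in> K" for u
  proof -
    have "real_of_int (b u) > 0" using bK[OF that] \<beta>(1) K that D(1) by auto
    thus ?thesis by simp
  qed
  have sb: "real_of_int (sum b K) = real D * sum \<beta> K"
    using bK by (simp add: sum_distrib_left)
  have pb: "real_of_int (prod b K) = real D ^ card K * prod \<beta> K"
    using bK by (simp add: prod.distrib)
  have "sum \<beta> K \<le> sum \<beta> (I - {p})"
    using K finite_I \<beta>(1) by (intro sum_mono2) (auto simp: less_imp_le)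
  also have "\<dots> < 1"
    using sum.remove[OF finite_I p_in_I, of \<beta>] \<beta> p_in_I by force
  finally have "sum \<beta> K < 1" .
  hence "real_of_int (sum b K) < real_of_int (int D)" using sb D(1) by simp
  hence slt: "sum b K < int D" by linarith
  have "card K > 0" using finK \<open>K \<noteq> {}\<close> by (simp add: card_gt_0_iff)
  hence cK: "real D ^ card K = real D * real D ^ (card K - 1)"
    by (metis power_minus_mult mult.commute)
  \<comment> \<open>After multiplication by \<open>D ^ card K\<close>, the negated claim is the size
    hypothesis of \<open>integer_linear_forms\<close>.\<close>
  have "real_of_int ((int D - sum b K) * int D ^ (card K - 1))
      = real D ^ card K * (1 - sum \<beta> K)"
    by (simp add: sb[simplified] cK algebra_simps)
  also have "\<dots> < real D ^ card K * prod \<beta> K"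
    using gt D(1) by (intro mult_strict_left_mono) auto
  also have "\<dots> = real_of_int (prod b K)" by (simp only: pb)
  finally have "(int D - sum b K) * int D ^ (card K - 1) < prod b K" by linarith
  from integer_linear_forms[OF finK \<open>K \<noteq> {}\<close> b0 slt this]
  obtain n t where nt: "t \<ge> 1" "sum n K = t" "\<And>u. u \<in> K \<Longrightarrow> \<bar>int D * n u - b u * t\<bar> < b u"
    by blast
  \<comment> \<open>The \<open>(t + 1)\<close>-fold coordinates sum to \<open>t + 1\<close>, and
    subtracting the \<open>n u\<close>, whose sum is \<open>t\<close>, restores the sum 1. The
    estimate on \<open>D * n u - b u * t\<close> keeps the coordinates in \<open>K\<close> positive;
    the one at \<open>p\<close> is just multiplied by \<open>t + 1 \<ge> 2\<close>.\<close>
  define m where "m u = (if u \<in> K then n u else 0)" for u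
  define T where "T = real_of_int t + 1"
  have T: "T \<ge> 2" using nt(1) by (simp add: T_def)
  define \<gamma> where "\<gamma> u = T * \<beta> u - real_of_int (m u)" for u
  have pos: "\<gamma> u > 0" if "u \<in> I" for u
  proof (cases "u \<in> K")
    case True
    have "int D * n u < b u * (t + 1)"
      using nt(3)[OF True] by (simp add: abs_less_iff algebra_simps)
    hence "real_of_int (int D * n u) < real_of_int (b u * (t + 1))" by (simp only: of_int_less_iff)
    hence "real D * real_of_int (n u) < real D * (\<beta> u * T)"
      using bK[OF True] by (simp add: T_def mult.assoc)
    thus ?thesis using D(1) True by (simp add: \<gamma>_def m_def mult.commute)
  next
    case False
    thus ?thesis using \<beta>(1) that T by (simp add: \<gamma>_def m_def)
  qed
  have KI: "K \<subseteq> I" using K by auto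
  have "sum m I = sum n K"
    using sum.mono_neutral_cong_right[OF finite_I KI, of m n] by (simp add: m_def)
  hence "(\<Sum>u\<in>I. real_of_int (m u)) = real_of_int t" using nt(2) by (metis of_int_sum)
  hence sum1: "sum \<gamma> I = 1"
    using \<beta>(2) by (simp add: \<gamma>_def sum_subtractf sum_distrib_left[symmetric] T_def)
  have "(\<Sum>u\<in>I. \<gamma> u *\<^sub>R u) + (T * c) *\<^sub>R w
      = T *\<^sub>R ((\<Sum>u\<in>I. \<beta> u *\<^sub>R u) + c *\<^sub>R w) - (\<Sum>u\<in>I. real_of_int (m u) *\<^sub>R u)"
    by (simp add: \<gamma>_def scaleR_diff_left sum_subtractf scaleR_add_right scaleR_sum_right)
  also have "\<dots> \<in> integral_points"
    using I_integral by (intro integral_points_diff integral_points_sum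
      integral_points_scaleR[OF \<beta>(3)]) (auto simp: T_def intro: integral_points_scaleR)
  finally have "admissible \<gamma>" unfolding admissible_def using pos sum1 by blast
  from large[OF this] have "\<gamma> p < 2 * \<beta> p" .
  moreover have "\<gamma> p = T * \<beta> p" using K by (auto simp: \<gamma>_def m_def)
  moreover have "T * \<beta> p \<ge> 2 * \<beta> p" using T \<beta>(1) p_in_I by (intro mult_right_mono) (auto simp: less_imp_le)
  ultimately show False by simp
qed

text \<open>The product inequalities bound the sum of the coordinates other than
  \<open>\<beta> p\<close> and thus bound \<open>\<beta> p\<close> from below, while
  \<open>\<beta> p * l \<le> 1\<close>. If \<open>l\<close> is extremal, every estimate is tight:
  \<open>card I\<close> is the dimension, the other coordinates are the Sylvester reciprocals, and
  offset 0 is integral.\<close>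

lemma segment_length_bound:
  shows "l \<le> real (sylvester CARD('n)) - 1"
    and "l = real (sylvester CARD('n)) - 1 \<Longrightarrow>
      card I = CARD('n) \<and> (\<exists>e. bij_betw e {..<CARD('n) - 1} (I - {p}) \<and>
        (\<Sum>i<CARD('n) - 1. (1 / real (sylvester (Suc i))) *\<^sub>R (e i - p)) \<in> integral_points)"
proof -
  obtain \<beta> where adm: "admissible \<beta>" and large: "\<And>\<gamma>. admissible \<gamma> \<Longrightarrow> \<gamma> p < 2 * \<beta> p"
    using ex_admissible_large by blast
  have \<beta>: "\<forall>u\<in>I. \<beta> u > 0" "sum \<beta> I = 1" using adm by (auto simp: admissible_def)
  have c: "card I > 0" using finite_I p_in_I by (auto simp: card_gt_0_iff)
  have card: "Suc (card (I - {p})) = card I" using finite_I p_in_I by (rule card_Suc_Diff1)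
  have bp: "\<beta> p = 1 - sum \<beta> (I - {p})"
    using sum.remove[OF finite_I p_in_I, of \<beta>] \<beta>(2) by simp
  have fin: "finite (I - {p})" using finite_I by simp
  have pos: "\<beta> u > 0" if "u \<in> I - {p}" for u using \<beta>(1) that by auto
  have prods: "prod \<beta> K \<le> 1 - sum \<beta> K" if "K \<subseteq> I - {p}" for K
    by (rule prod_le_of_large[OF adm _ that]) (rule large)
  \<comment> \<open>There are \<open>card I - 1\<close> coordinates besides that of
    \<open>p\<close>, so the Sylvester term of index \<open>card I\<close> appears.\<close>
  note syl = sum_le_sylvester[of "I - {p}" \<beta>, OF fin pos prods, unfolded card]
  have s2: "real (sylvester n) - 1 \<ge> 1" for n using sylvester_ge_2[of n] by simp
  have ge: "\<beta> p \<ge> 1 / (real (sylvester (card I)) - 1)" using syl(1) bp by linarith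
  have pl: "\<beta> p * l \<le> 1" using admissible_le(1)[OF adm] .
  have "1 / (real (sylvester (card I)) - 1) * l \<le> \<beta> p * l"
    using ge l(1) by (intro mult_right_mono) auto
  hence "l / (real (sylvester (card I)) - 1) \<le> 1" using pl by simp
  hence lI: "l \<le> real (sylvester (card I)) - 1" using s2[of "card I"] by (simp add: divide_le_eq)
  have le: "sylvester (card I) \<le> sylvester CARD('n)"
    using sylvester_strict_mono[of "card I" "CARD('n)"] card_I_le c
    by (cases "card I = CARD('n)") auto
  show "l \<le> real (sylvester CARD('n)) - 1" using lI le by linarith
  assume eq: "l = real (sylvester CARD('n)) - 1"
  have "sylvester (card I) = sylvester CARD('n)" using lI le eq by linarith
  hence cI: "card I = CARD('n)"
    using sylvester_strict_mono[of "card I" "CARD('n)"] card_I_le c by fastforce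
  have l0: "l \<ge> 1" using eq s2 by simp
  have "\<beta> p \<ge> 1 / l" using ge cI eq by simp
  hence "\<beta> p * l \<ge> 1" using l0 by (simp add: divide_le_eq)
  hence pl1: "\<beta> p * l = 1" using pl by simp
  hence "\<beta> p = 1 / l" using l0 by (simp add: field_simps)
  hence "sum \<beta> (I - {p}) = 1 - 1 / (real (sylvester (card I)) - 1)"
    using bp cI eq by simp
  from syl(2)[OF _ _ this] obtain e where e: "bij_betw e {..<card (I - {p})} (I - {p})"
    "\<forall>i<card (I - {p}). \<beta> (e i) = 1 / real (sylvester (Suc i))"
    by blast
  have ck: "card (I - {p}) = CARD('n) - 1" using card cI by simp
  have "(\<Sum>i<CARD('n) - 1. (1 / real (sylvester (Suc i))) *\<^sub>R (e i - p))
      = (\<Sum>i<CARD('n) - 1. \<beta> (e i) *\<^sub>R (e i - p))"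
    using e(2) ck by (intro sum.cong) auto
  also have "\<dots> = (\<Sum>u\<in>I - {p}. \<beta> u *\<^sub>R (u - p))"
    using e(1)[unfolded ck] by (rule sum.reindex_bij_betw)
  also have "\<dots> = (\<Sum>u\<in>I. \<beta> u *\<^sub>R (u - p))"
    using sum.remove[OF finite_I p_in_I, of "\<lambda>u. \<beta> u *\<^sub>R (u - p)"] by simp
  also have "\<dots> = (\<Sum>u\<in>I. \<beta> u *\<^sub>R u) - p"
    using \<beta>(2) by (simp add: scaleR_diff_right sum_subtractf scaleR_sum_left[symmetric])
  also have "\<dots> \<in> integral_points"
    using admissible_le(2)[OF adm pl1] I_integral[OF p_in_I] by (rule integral_points_diff)
  finally show "card I = CARD('n) \<and> (\<exists>e. bij_betw e {..<CARD('n) - 1} (I - {p}) \<and>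
        (\<Sum>i<CARD('n) - 1. (1 / real (sylvester (Suc i))) *\<^sub>R (e i - p)) \<in> integral_points)"
    using cI e(1)[unfolded ck] by blast
qed

end

section \<open>The extremal simplex\<close>

text \<open>Multiplying the sum by the product \<open>N\<close> of the other \<open>s j\<close>
  clears their denominators, so \<open>N * r i\<close> is an integer. So is
  \<open>s i * r i\<close>, and Bezout's identity for the coprime \<open>N\<close> and
  \<open>s i\<close> combines the two.\<close>

lemma Ints_of_coprime_denominators:
  fixes r :: "'a \<Rightarrow> real" and s :: "'a \<Rightarrow> nat"
  assumes fin: "finite A"
    and cop: "\<And>i j. i \<in> A \<Longrightarrow> j \<in> A \<Longrightarrow> i \<noteq> j \<Longrightarrow> coprime (s i) (s j)"
    and int: "\<And>i. i \<in> A \<Longrightarrow> real (s i) * r i \<in> \<int>"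
    and sum: "sum r A \<in> \<int>" and i: "i \<in> A"
  shows "r i \<in> \<int>"
proof -
  define N where "N = prod s (A - {i})"
  have "real N * r j \<in> \<int>" if "j \<in> A - {i}" for j
  proof -
    have "N = s j * prod s (A - {i} - {j})" unfolding N_def using fin that by (intro prod.remove) auto
    hence "real N * r j = real (prod s (A - {i} - {j})) * (real (s j) * r j)" by simp
    also have "\<dots> \<in> \<int>" using that by (intro Ints_mult[OF Ints_of_nat int]) auto
    finally show ?thesis .
  qed
  hence "(\<Sum>j\<in>A - {i}. real N * r j) \<in> \<int>" by (intro Ints_sum) auto
  moreover have "real N * sum r A \<in> \<int>" using sum by (rule Ints_mult[OF Ints_of_nat])
  moreover have "real N * r i = real N * sum r A - (\<Sum>j\<in>A - {i}. real N * r j)"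
    using sum.remove[OF fin i, of r] by (simp add: sum_distrib_left algebra_simps)
  ultimately have Ni: "real N * r i \<in> \<int>" by (metis Ints_diff)
  have "coprime N (s i)" unfolding N_def using cop i by (intro prod_coprime_left) auto
  hence "coprime (int N) (int (s i))" by simp
  then obtain a b where ab: "a * int N + b * int (s i) = 1"
    using bezout_int[of "int N" "int (s i)"] by (auto simp: coprime_iff_gcd_eq_1)
  hence "real_of_int (a * int N + b * int (s i)) = 1" by simp
  hence "r i = real_of_int a * (real N * r i) + real_of_int b * (real (s i) * r i)"
    by (simp add: distrib_right[symmetric] mult.assoc[symmetric])
  also have "\<dots> \<in> \<int>" using Ni int[OF i] by (intro Ints_add Ints_mult[OF Ints_of_int])
  finally show ?thesis .
qed

text \<open>The weight missing from 1 is placed on the point 0.\<close>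

lemma convex_sum_le_one:
  assumes "finite A" "convex S" "0 \<in> S" "\<And>i. i \<in> A \<Longrightarrow> u i \<ge> 0" "sum u A \<le> 1" "\<And>i. i \<in> A \<Longrightarrow> f i \<in> S"
  shows "(\<Sum>i\<in>A. u i *\<^sub>R f i) \<in> S"
proof (cases "sum u A = 0")
  case True
  hence "\<forall>i\<in>A. u i = 0" using assms by (simp add: sum_nonneg_eq_0_iff)
  thus ?thesis using assms(3) by simp
next
  case False
  define \<sigma> where "\<sigma> = sum u A"
  have \<sigma>: "\<sigma> > 0" using False sum_nonneg[of A u, OF assms(4)] unfolding \<sigma>_def by linarith
  have "(\<Sum>i\<in>A. (u i / \<sigma>) *\<^sub>R f i) \<in> S"
    using assms \<sigma> by (intro convex_sum) (auto simp: sum_divide_distrib[symmetric] \<sigma>_def)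
  hence "\<sigma> *\<^sub>R (\<Sum>i\<in>A. (u i / \<sigma>) *\<^sub>R f i) + (1 - \<sigma>) *\<^sub>R 0 \<in> S"
    using assms \<sigma> by (intro convexD) (auto simp: \<sigma>_def)
  thus ?thesis using \<sigma> by (simp add: scaleR_sum_right)
qed

text \<open>Every facet of the simplex \<open>{y \<ge> 0, \<Sum> y\<^sub>j / a\<^sub>j \<le> 1}\<close> has a 0/1-point in its relative
  interior, so that a lattice-free convex set cannot properly contain the simplex.\<close>
lemma lattice_free_simplex_maximal:
  fixes C :: "(real ^ 'n) set" and a :: "'n \<Rightarrow> real"
  assumes C: "convex C" and hull: "convex hull (insert 0 (range (\<lambda>j. a j *\<^sub>R axis j 1))) \<subseteq> C"
    and a: "\<And>j. a j > 0" "(\<Sum>j\<in>UNIV. 1 / a j) = 1"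
    and free: "interior C \<inter> integral_points = {}"
  shows "\<And>y. (\<And>j. y $ j > 0) \<Longrightarrow> (\<Sum>j\<in>UNIV. y $ j / a j) < 1 \<Longrightarrow> y \<in> interior C"
    and "C = convex hull (insert 0 (range (\<lambda>j. a j *\<^sub>R axis j 1)))"
proof -
  let ?H = "convex hull (insert 0 (range (\<lambda>j. a j *\<^sub>R axis j 1)))"
  have sub: "y \<in> ?H" if "\<And>j. y $ j \<ge> 0" "(\<Sum>j\<in>UNIV. y $ j / a j) \<le> 1" for y
  proof -
    have "(\<Sum>j\<in>UNIV. (y $ j / a j) *\<^sub>R (a j *\<^sub>R axis j 1)) \<in> ?H"
      using that a(1) by (intro convex_sum_le_one) (auto simp: less_imp_le intro: hull_inc)
    also have "(\<Sum>j\<in>UNIV. (y $ j / a j) *\<^sub>R (a j *\<^sub>R axis j 1)) = (\<Sum>j\<in>UNIV. y $ j *\<^sub>R axis j 1)"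
      using a(1) by (intro sum.cong) (auto simp: less_imp_neq[symmetric])
    also have "\<dots> = y"
      using basis_expansion[of y] by (simp add: scalar_mult_eq_scaleR)
    finally show ?thesis .
  qed
  define U where "U = {y. \<forall>j. 0 < y $ j} \<inter> {y. (\<Sum>j\<in>UNIV. y $ j / a j) < 1}"
  have "open {y :: real ^ 'n. \<forall>j. 0 < y $ j}"
  proof -
    have "{y :: real ^ 'n. \<forall>j. 0 < y $ j} = (\<Inter>j. {y. 0 < y $ j})" by auto
    also have "open \<dots>" by (intro open_INT ballI open_Collect_less continuous_intros) auto
    finally show ?thesis .
  qed
  moreover have "open {y :: real ^ 'n. (\<Sum>j\<in>UNIV. y $ j / a j) < 1}"
    using a(1) by (intro open_Collect_less continuous_intros) (auto simp: less_imp_neq[symmetric])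
  ultimately have "open U" unfolding U_def by (rule open_Int)
  moreover have "U \<subseteq> C" using sub hull by (auto simp: U_def less_imp_le)
  ultimately have UC: "U \<subseteq> interior C" by (rule interior_maximal[rotated])
  show "y \<in> interior C" if "\<And>j. y $ j > 0" "(\<Sum>j\<in>UNIV. y $ j / a j) < 1" for y
    using that UC by (auto simp: U_def)
  \<comment> \<open>By \<open>ev\<close>, the ray from \<open>z\<close> through \<open>v\<close>
    enters the open simplex \<open>U\<close> just beyond \<open>v\<close>; convexity then makes the
    lattice point \<open>v\<close> interior to \<open>C\<close>.\<close>
  have push: False if z: "z \<in> C" and v: "v \<in> integral_points"
    and ev: "eventually (\<lambda>\<epsilon>. \<forall>j. 0 < (v - \<epsilon> *\<^sub>R (z - v)) $ j) (at_right 0)"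
      "eventually (\<lambda>\<epsilon>. (\<Sum>j\<in>UNIV. (v - \<epsilon> *\<^sub>R (z - v)) $ j / a j) < 1) (at_right 0)" for z v
  proof -
    have "eventually (\<lambda>\<epsilon>::real. \<epsilon> > 0) (at_right 0)" by (simp add: eventually_at_right_less)
    from eventually_happens'[OF _ eventually_conj[OF this eventually_conj[OF ev]]]
    obtain \<epsilon> where \<epsilon>: "\<epsilon> > 0" "\<forall>j. 0 < (v - \<epsilon> *\<^sub>R (z - v)) $ j"
        "(\<Sum>j\<in>UNIV. (v - \<epsilon> *\<^sub>R (z - v)) $ j / a j) < 1"
      by (auto simp: trivial_limit_at_right_real)
    define y where "y = v - \<epsilon> *\<^sub>R (z - v)"
    have "y \<in> U" using \<epsilon> by (simp only: U_def y_def Int_iff mem_Collect_eq simp_thms)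
    hence "z - (1 / (1 + \<epsilon>)) *\<^sub>R (z - y) \<in> interior C"
      using UC z \<epsilon>(1) by (intro mem_interior_convex_shrink C) auto
    moreover have "z - y = (1 + \<epsilon>) *\<^sub>R (z - v)" by (simp add: y_def algebra_simps)
    ultimately have "v \<in> interior C" using \<epsilon>(1) by simp
    thus False using v free by auto
  qed
  have lim: "((\<lambda>\<epsilon>. (v - \<epsilon> *\<^sub>R (z - v)) $ j) \<longlongrightarrow> v $ j) (at_right 0)" for v z :: "real ^ 'n" and j
    by (rule tendsto_eq_intros refl | simp)+
  have lims: "((\<lambda>\<epsilon>. \<Sum>j\<in>UNIV. (v - \<epsilon> *\<^sub>R (z - v)) $ j / a j) \<longlongrightarrow> (\<Sum>j\<in>UNIV. v $ j / a j)) (at_right 0)"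
    for v z :: "real ^ 'n"
    using a(1) by (intro tendsto_intros lim) (auto simp: less_imp_neq[symmetric])
  have nonneg: "z $ i \<ge> 0" if z: "z \<in> C" for z i
  proof (rule ccontr)
    assume "\<not> z $ i \<ge> 0"
    hence neg: "z $ i < 0" by simp
    \<comment> \<open>The lattice point in the relative interior of the facet on which coordinate
      \<open>i\<close> vanishes.\<close>
    define v :: "real ^ 'n" where "v = (\<chi> j. if j = i then 0 else 1)"
    have "v \<in> integral_points" by (auto simp: v_def integral_points_def)
    moreover have "eventually (\<lambda>\<epsilon>. \<forall>j. 0 < (v - \<epsilon> *\<^sub>R (z - v)) $ j) (at_right 0)"
    proof (rule eventually_all_finite)
      fix j
      show "eventually (\<lambda>\<epsilon>. 0 < (v - \<epsilon> *\<^sub>R (z - v)) $ j) (at_right 0)"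
      proof (cases "j = i")
        case True
        have "eventually (\<lambda>\<epsilon>::real. \<epsilon> > 0) (at_right 0)" by (simp add: eventually_at_right_less)
        thus ?thesis
          by eventually_elim (use True neg in \<open>simp add: v_def mult_pos_neg\<close>)
      next
        case False
        thus ?thesis using order_tendstoD(1)[OF lim[of v z j], of 0] by (simp add: v_def)
      qed
    qed
    moreover have "eventually (\<lambda>\<epsilon>. (\<Sum>j\<in>UNIV. (v - \<epsilon> *\<^sub>R (z - v)) $ j / a j) < 1) (at_right 0)"
    proof (rule order_tendstoD(2)[OF lims])
      have "(\<Sum>j\<in>UNIV. v $ j / a j) < (\<Sum>j\<in>UNIV. 1 / a j)"
      proof (rule sum_strict_mono_ex1)
        show "\<forall>j\<in>UNIV. v $ j / a j \<le> 1 / a j" using a(1) by (auto simp: v_def less_imp_le)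
        show "\<exists>j\<in>UNIV. v $ j / a j < 1 / a j" using a(1) by (intro bexI[of _ i]) (auto simp: v_def)
      qed simp
      thus "(\<Sum>j\<in>UNIV. v $ j / a j) < 1" using a(2) by simp
    qed
    ultimately show False by (rule push[OF z])
  qed
  have le1: "(\<Sum>j\<in>UNIV. z $ j / a j) \<le> 1" if z: "z \<in> C" for z
  proof (rule ccontr)
    assume "\<not> (\<Sum>j\<in>UNIV. z $ j / a j) \<le> 1"
    hence gt: "(\<Sum>j\<in>UNIV. z $ j / a j) > 1" by simp
    \<comment> \<open>This point lies on the remaining facet because the \<open>1 / a j\<close> sum
      to 1.\<close>
    define v :: "real ^ 'n" where "v = (\<chi> j. 1)"
    have "v \<in> integral_points" by (auto simp: v_def integral_points_def)
    moreover have "eventually (\<lambda>\<epsilon>. \<forall>j. 0 < (v - \<epsilon> *\<^sub>R (z - v)) $ j) (at_right 0)"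
      using order_tendstoD(1)[OF lim[of v z], of 0]
      by (intro eventually_all_finite) (simp add: v_def)
    moreover have "eventually (\<lambda>\<epsilon>. (\<Sum>j\<in>UNIV. (v - \<epsilon> *\<^sub>R (z - v)) $ j / a j) < 1) (at_right 0)"
    proof -
      \<comment> \<open>The limit for \<open>\<epsilon>\<close> tending to 0 is exactly 1, so the
        strict inequality is read off from the explicit dependence on
        \<open>\<epsilon>\<close>.\<close>
      have "(\<Sum>j\<in>UNIV. (v - \<epsilon> *\<^sub>R (z - v)) $ j / a j) = 1 - \<epsilon> * ((\<Sum>j\<in>UNIV. z $ j / a j) - 1)" for \<epsilon>
      proof -
        have "(\<Sum>j\<in>UNIV. (v - \<epsilon> *\<^sub>R (z - v)) $ j / a j)
            = (\<Sum>j\<in>UNIV. 1 / a j - \<epsilon> * (z $ j / a j - 1 / a j))"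
          by (intro sum.cong) (auto simp: v_def diff_divide_distrib right_diff_distrib)
        also have "\<dots> = 1 - \<epsilon> * ((\<Sum>j\<in>UNIV. z $ j / a j) - 1)"
          by (simp only: sum_subtractf sum_distrib_left[symmetric] a(2))
        finally show ?thesis .
      qed
      moreover have "eventually (\<lambda>\<epsilon>::real. \<epsilon> > 0) (at_right 0)" by (simp add: eventually_at_right_less)
      hence "eventually (\<lambda>\<epsilon>. 1 - \<epsilon> * ((\<Sum>j\<in>UNIV. z $ j / a j) - 1) < 1) (at_right 0)"
        by eventually_elim (use gt in simp)
      ultimately show ?thesis by (simp only:)
    qed
    ultimately show False by (rule push[OF z])
  qed
  show "C = ?H" using hull sub nonneg le1 by blast
qed

text \<open>A lattice point outside the lattice spanned by \<open>W\<close> could be translated into \<open>p\<close> plus the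
  half-open parallelepiped with coordinates in \<open>(0, 1]\<close>, which, apart from its corner \<open>(1, \<dots>, 1)\<close>,
  lies in the interior of the simplex.\<close>
lemma unimodularly_equivalent_simplex:
  fixes P :: "(real ^ 'n) set" and W :: "'n \<Rightarrow> real ^ 'n" and a :: "'n \<Rightarrow> real"
  assumes P: "convex P" and free: "interior P \<inter> integral_points = {}"
    and p: "p \<in> P" "p \<in> integral_points"
    and W: "\<And>j. W j \<in> integral_points" "\<And>j. p + a j *\<^sub>R W j \<in> P"
    and a: "\<And>j. a j > 0" "(\<Sum>j\<in>UNIV. 1 / a j) = 1"
    and surj: "surj (\<lambda>y :: real ^ 'n. \<Sum>j\<in>UNIV. y $ j *\<^sub>R W j)"
  shows "unimodularly_equivalent P (convex hull (insert 0 (range (\<lambda>j. a j *\<^sub>R axis j 1))))"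
proof -
  let ?H = "convex hull (insert 0 (range (\<lambda>j. a j *\<^sub>R axis j 1))) :: (real ^ 'n) set"
  define M where "M y = (\<Sum>j\<in>UNIV. y $ j *\<^sub>R W j)" for y :: "real ^ 'n"
  have lin: "linear M"
    unfolding M_def by (intro linearI) (auto simp: scaleR_add_left sum.distrib scaleR_sum_right)
  have surjM: "surj M" using surj by (simp add: M_def[abs_def])
  have injM: "inj M" using lin surjM by (rule linear_surj_imp_inj)
  have M_axis: "M (axis j c) = c *\<^sub>R W j" for j c
  proof -
    have "M (axis j c) = (\<Sum>i\<in>UNIV. if i = j then c *\<^sub>R W j else 0)"
      unfolding M_def by (intro sum.cong) (auto simp: axis_def)
    thus ?thesis by simp
  qed
  have M_int: "M y \<in> integral_points" if "y \<in> integral_points" for y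
    unfolding M_def using that W(1)
    by (intro integral_points_sum integral_points_scaleR) (auto simp: integral_points_def)
  define C where "C = {y. p + M y \<in> P}"
  have "convex C"
  proof (rule convexI)
    fix y z u v assume *: "y \<in> C" "z \<in> C" "0 \<le> u" "0 \<le> v" "u + v = (1::real)"
    have "p + M (u *\<^sub>R y + v *\<^sub>R z) = (u + v) *\<^sub>R p + u *\<^sub>R M y + v *\<^sub>R M z"
      using lin * by (simp add: linear_add linear_scale)
    also have "\<dots> = u *\<^sub>R (p + M y) + v *\<^sub>R (p + M z)"
      by (simp add: algebra_simps)
    also have "\<dots> \<in> P" using * P by (intro convexD) (auto simp: C_def)
    finally show "u *\<^sub>R y + v *\<^sub>R z \<in> C" by (simp add: C_def)
  qed
  have HC: "?H \<subseteq> C"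
  proof (rule hull_minimal)
    have "p + M (a j *\<^sub>R axis j 1) \<in> P" for j
      using W(2)[of j] M_axis[of j 1] lin by (simp add: linear_scale)
    thus "insert 0 (range (\<lambda>j. a j *\<^sub>R axis j 1)) \<subseteq> C"
      using p lin by (auto simp: C_def linear_0)
  qed fact
  have intC: "p + M y \<in> interior P" if "y \<in> interior C" for y
  proof -
    have "open ((+) p ` M ` interior C)"
      by (intro open_translation open_surjective_linear_image lin surjM open_interior)
    moreover have "(+) p ` M ` interior C \<subseteq> P" using interior_subset[of C] by (auto simp: C_def)
    ultimately have "(+) p ` M ` interior C \<subseteq> interior P" by (rule interior_maximal[rotated])
    thus ?thesis using that by auto
  qed
  have freeC: "interior C \<inter> integral_points = {}"
    using intC M_int integral_points_add[OF p(2)] free by blast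
  note simplex = lattice_free_simplex_maximal[OF \<open>convex C\<close> HC a freeC]
  have onto: "\<exists>y\<in>integral_points. M y = z" if z: "z \<in> integral_points" for z
  proof -
    obtain y where y: "M y = z" using surjM by (metis surjD)
    \<comment> \<open>Subtracting the ceiling minus 1 leaves coordinates in \<open>(0, 1]\<close>;
      they must be positive for \<open>simplex(1)\<close>.\<close>
    define k :: "real ^ 'n" where "k = (\<chi> j. of_int (\<lceil>y $ j\<rceil> - 1))"
    define v where "v = y - k"
    have v: "0 < v $ j" "v $ j \<le> 1" for j unfolding v_def k_def by (simp; linarith)+
    have k: "k \<in> integral_points" by (simp add: k_def integral_points_def)
    have "M v = z - M k" using lin y by (simp add: v_def linear_diff)
    hence Mv: "M v \<in> integral_points" using integral_points_diff[OF z M_int[OF k]] by simp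
    have v1: "v $ j = 1" for j
    proof (rule ccontr)
      assume "v $ j \<noteq> 1"
      hence lt: "v $ j < 1" using v(2)[of j] by simp
      have "(\<Sum>j\<in>UNIV. v $ j / a j) < (\<Sum>j\<in>UNIV. 1 / a j)"
      proof (rule sum_strict_mono_ex1)
        show "\<forall>j\<in>UNIV. v $ j / a j \<le> 1 / a j" using a(1) v(2) by (auto simp: less_imp_le divide_right_mono)
        show "\<exists>j\<in>UNIV. v $ j / a j < 1 / a j"
          using a(1) lt by (intro bexI[of _ j]) (auto simp: divide_strict_right_mono)
      qed simp
      hence "v \<in> interior C" using v(1) a(2) by (intro simplex(1)) auto
      thus False using intC free integral_points_add[OF p(2) Mv] by blast
    qed
    have "y $ j = of_int \<lceil>y $ j\<rceil>" for j using v1[of j] by (simp add: v_def k_def)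
    hence "y $ j \<in> \<int>" for j by (metis Ints_of_int)
    thus ?thesis using y by (auto simp: integral_points_def)
  qed
  define L where "L = inv M"
  have linL: "linear L" unfolding L_def using lin injM by (rule inj_linear_imp_inv_linear)
  have L_M: "L (M y) = y" for y unfolding L_def using injM by simp
  have M_L: "M (L z) = z" for z unfolding L_def using surjM by (simp add: surj_f_inv_f)
  define f where "f z = L z + - L p" for z
  have f_inv: "f (p + M y) = y" "p + M (f z) = z" for y z
    using linL lin L_M M_L by (simp_all add: f_def linear_add linear_diff)
  have "bij f" by (rule bij_betw_byWitness[where f'="\<lambda>y. p + M y"]) (auto simp: f_inv)
  moreover have "f ` integral_points = integral_points"
  proof (intro equalityI subsetI)
    fix z assume "z \<in> f ` integral_points"
    then obtain u where u: "u \<in> integral_points" "z = f u" by auto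
    obtain y where "y \<in> integral_points" "M y = u - p"
      using onto[OF integral_points_diff[OF u(1) p(2)]] by auto
    thus "z \<in> integral_points" using u f_inv(1)[of y] by simp
  next
    fix z :: "real ^ 'n" assume z: "z \<in> integral_points"
    have "z = f (p + M z)" by (simp add: f_inv)
    thus "z \<in> f ` integral_points" using integral_points_add[OF p(2) M_int[OF z]] by blast
  qed
  moreover have "f ` P = ?H"
  proof -
    have "f ` P = C"
    proof (intro equalityI subsetI)
      fix z assume "z \<in> f ` P"
      thus "z \<in> C" using f_inv(2) by (auto simp: C_def)
    next
      fix z assume "z \<in> C"
      hence "p + M z \<in> P" by (simp add: C_def)
      moreover have "z = f (p + M z)" by (simp add: f_inv)
      ultimately show "z \<in> f ` P" by blast
    qed
    thus ?thesis using simplex(2) by simp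
  qed
  ultimately show ?thesis
    unfolding unimodularly_equivalent_def using linL
    by (intro exI[of _ f] exI[of _ L] exI[of _ "- L p"]) (simp add: f_def)
qed

text \<open>Indexes the vertices by coordinates, the form in which
  \<open>unimodularly_equivalent_simplex\<close> produces the simplex.\<close>

lemma simplex_S0_eq:
  fixes \<iota> :: "nat \<Rightarrow> 'n::finite"
  assumes "bij_betw \<iota> {1..CARD('n)} UNIV"
    and "\<And>i. i \<in> {1..<CARD('n)} \<Longrightarrow> a (\<iota> i) = real (sylvester i)"
    and "a (\<iota> CARD('n)) = real (sylvester CARD('n)) - 1"
  shows "simplex_S0 \<iota> = convex hull (insert 0 (range (\<lambda>j. a j *\<^sub>R axis j 1)))"
proof -
  have "(UNIV :: 'n set) = \<iota> ` {1..CARD('n)}" using assms(1) by (simp add: bij_betw_def)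
  also have "{1..CARD('n)} = insert CARD('n) {1..<CARD('n)}"
    using zero_less_card_finite[where 'a='n] by (intro set_eqI) (auto simp: Suc_le_eq)
  finally have U: "(UNIV :: 'n set) = \<iota> ` insert CARD('n) {1..<CARD('n)}" .
  have "range (\<lambda>j. a j *\<^sub>R axis j (1::real)) = insert (a (\<iota> CARD('n)) *\<^sub>R axis (\<iota> CARD('n)) 1)
     ((\<lambda>i. a (\<iota> i) *\<^sub>R axis (\<iota> i) 1) ` {1..<CARD('n)})"
    using arg_cong[OF U, of "image (\<lambda>j. a j *\<^sub>R axis j (1::real))"]
    by (simp only: image_insert image_image)
  also have "(\<lambda>i. a (\<iota> i) *\<^sub>R axis (\<iota> i) (1::real)) ` {1..<CARD('n)}
     = (\<lambda>i. real (sylvester i) *\<^sub>R axis (\<iota> i) 1) ` {1..<CARD('n)}"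
    using assms(2) by (intro image_cong) auto
  finally show ?thesis
    unfolding simplex_S0_def Setcompr_eq_image by (simp add: assms(3))
qed

text \<open>The vectors \<open>\<omega> i\<close> have an integral sum and pairwise coprime
  denominators, so each is integral. Together with \<open>w\<close> they are the edge directions of
  a simplex at \<open>p\<close> inside \<open>P\<close> whose edge lengths have reciprocals summing
  to 1.\<close>

lemma (in lattice_free_segment) extremal_simplex:
  assumes eq: "l = real (sylvester CARD('n)) - 1"
    and \<iota>: "bij_betw \<iota> {1..CARD('n)} (UNIV :: 'n set)"
  shows "unimodularly_equivalent P (simplex_S0 \<iota>)"
proof -
  define d where "d = CARD('n)"
  have d: "d > 0" by (simp add: d_def)
  from segment_length_bound(2)[OF eq] obtain e where cI: "card I = d"
    and e: "bij_betw e {..<d - 1} (I - {p})"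
    and int: "(\<Sum>i<d - 1. (1 / real (sylvester (Suc i))) *\<^sub>R (e i - p)) \<in> integral_points"
    unfolding d_def by blast
  have eI: "e i \<in> I" if "i < d - 1" for i using e that by (auto simp: bij_betw_def)
  define \<omega> where "\<omega> i = (1 / real (sylvester (Suc i))) *\<^sub>R (e i - p)" for i
  have s0: "real (sylvester n) > 0" for n using sylvester_pos by simp
  have \<omega>: "\<omega> i \<in> integral_points" if i: "i < d - 1" for i
    unfolding integral_points_def
  proof safe
    fix j
    show "\<omega> i $ j \<in> \<int>"
    proof (rule Ints_of_coprime_denominators[where A="{..<d - 1}" and s="\<lambda>i. sylvester (Suc i)"
          and r="\<lambda>i. \<omega> i $ j"])
      show "coprime (sylvester (Suc i)) (sylvester (Suc k))" if "i \<noteq> k" for i k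
        using sylvester_coprime[of i k] sylvester_coprime[of k i] that
        by (metis coprime_commute linorder_neqE_nat)
      show "real (sylvester (Suc i)) * \<omega> i $ j \<in> \<int>" if "i \<in> {..<d - 1}" for i
      proof -
        have "real (sylvester (Suc i)) * \<omega> i $ j = (e i - p) $ j"
          using s0[of "Suc i"] by (simp add: \<omega>_def)
        also have "\<dots> \<in> \<int>"
          using integral_points_diff[OF I_integral I_integral[OF p_in_I], of "e i"] eI that
          by (auto simp: integral_points_def)
        finally show ?thesis .
      qed
      have "(\<Sum>i<d - 1. \<omega> i) $ j \<in> \<int>" using int by (simp add: \<omega>_def integral_points_def del: sum_component)
      thus "(\<Sum>i<d - 1. \<omega> i $ j) \<in> \<int>" by simp
    qed (use i in auto)
  qed
  define \<kappa> where "\<kappa> = the_inv_into {1..d} \<iota>"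
  have bij: "bij_betw \<iota> {1..d} UNIV" using \<iota> by (simp add: d_def)
  have \<kappa>: "\<kappa> (\<iota> i) = i" if "i \<in> {1..d}" for i
    using bij that unfolding \<kappa>_def by (simp add: the_inv_into_f_f bij_betw_def)
  have \<iota>_ex: "\<exists>i\<in>{1..d}. j = \<iota> i" for j using bij by (auto simp: bij_betw_def)
  \<comment> \<open>The last index carries \<open>w\<close> with edge length \<open>l\<close>.
    Elsewhere the index drops by one, as \<open>\<iota>\<close> counts from 1 and
    \<open>\<omega>\<close> from 0.\<close>
  define W where "W j = (if \<kappa> j = d then w else \<omega> (\<kappa> j - 1))" for j
  define a where "a j = (if \<kappa> j = d then l else real (sylvester (\<kappa> j)))" for j
  have Wd: "W (\<iota> d) = w" "a (\<iota> d) = l" using \<kappa>[of d] d by (auto simp: W_def a_def)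
  have Wi: "W (\<iota> i) = \<omega> (i - 1)" "a (\<iota> i) = real (sylvester i)" if "i \<in> {1..<d}" for i
    using \<kappa>[of i] that by (auto simp: W_def a_def)
  have split: "Q j" if "Q (\<iota> d)" "\<And>i. i \<in> {1..<d} \<Longrightarrow> Q (\<iota> i)" for Q j
    using \<iota>_ex[of j] that by (metis atLeastAtMost_iff atLeastLessThan_iff order.order_iff_strict)
  have "unimodularly_equivalent P (convex hull (insert 0 (range (\<lambda>j. a j *\<^sub>R axis j 1))))"
  proof (rule unimodularly_equivalent_simplex[OF convex_P free])
    show "p \<in> P" "p \<in> integral_points" using V V_subset by auto
    show "W j \<in> integral_points" for j
      by (rule split) (use w Wd Wi \<omega> in auto)
    show "p + a j *\<^sub>R W j \<in> P" for j
    proof (rule split)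
      show "p + a (\<iota> d) *\<^sub>R W (\<iota> d) \<in> P" using Wd l by simp
      fix i assume i: "i \<in> {1..<d}"
      hence "a (\<iota> i) *\<^sub>R W (\<iota> i) = e (i - 1) - p"
        using Wi[OF i] s0[of i] by (simp add: \<omega>_def)
      moreover have "e (i - 1) \<in> P" using eI[of "i - 1"] i I_subset V_subset by fastforce
      ultimately show "p + a (\<iota> i) *\<^sub>R W (\<iota> i) \<in> P" by simp
    qed
    show "a j > 0" for j by (rule split) (use Wd Wi l s0 in auto)
    show "(\<Sum>j\<in>UNIV. 1 / a j) = 1"
    proof -
      have "(\<Sum>j\<in>UNIV. 1 / a j) = (\<Sum>i\<in>{1..d}. 1 / a (\<iota> i))"
        using sum.reindex_bij_betw[OF bij, of "\<lambda>j. 1 / a j"] by simp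
      also have "{1..d} = insert d {1..<d}" using d by auto
      also have "(\<Sum>i\<in>insert d {1..<d}. 1 / a (\<iota> i)) = 1 / l + (\<Sum>i\<in>{1..<d}. 1 / a (\<iota> i))"
        using Wd by simp
      also have "(\<Sum>i\<in>{1..<d}. 1 / a (\<iota> i)) = (\<Sum>i<d - 1. 1 / real (sylvester (Suc i)))"
        by (rule sum.reindex_bij_witness[where i=Suc and j="\<lambda>i. i - 1"]) (auto simp: Wi)
      also have "1 / l + \<dots> = 1"
        using sum_inverse_sylvester'[of "d - 1"] d eq by (simp add: d_def)
      finally show ?thesis .
    qed
    show "surj (\<lambda>y :: real ^ 'n. \<Sum>j\<in>UNIV. y $ j *\<^sub>R W j)" (is "surj ?M")
    proof -
      have lin: "linear ?M"
        by (intro linearI) (auto simp: scaleR_add_left sum.distrib scaleR_sum_right)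
      have M_axis: "c *\<^sub>R W j \<in> range ?M" for j c
      proof -
        have "?M (axis j c) = (\<Sum>i\<in>UNIV. if i = j then c *\<^sub>R W j else 0)"
          by (intro sum.cong) (auto simp: axis_def)
        thus ?thesis by (intro image_eqI[of _ _ "axis j c"]) auto
      qed
      \<comment> \<open>Each direction is a multiple of some \<open>W j\<close>, and the directions
        span the space, being independent and as many as the dimension.\<close>
      have "directions \<subseteq> range ?M"
      proof
        fix v assume "v \<in> directions"
        then consider "v = w" | u where "u \<in> I - {p}" "v = u - p" by (auto simp: directions_def)
        thus "v \<in> range ?M"
        proof cases
          case 1
          thus ?thesis using M_axis[of 1 "\<iota> d"] Wd by simp
        next
          case 2
          obtain i where i: "i < d - 1" "u = e i" using e 2(1) by (auto simp: bij_betw_def)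
          have "v = real (sylvester (Suc i)) *\<^sub>R W (\<iota> (Suc i))"
            using Wi[of "Suc i"] i 2(2) s0[of "Suc i"] by (simp add: \<omega>_def)
          thus ?thesis by (simp only: M_axis)
        qed
      qed
      hence "span directions \<subseteq> range ?M"
        by (intro span_minimal linear_subspace_image lin) auto
      moreover have "UNIV \<subseteq> span directions"
        by (rule card_ge_dim_independent) (auto simp: independent_directions card_directions cI d_def)
      ultimately show ?thesis by auto
    qed
  qed
  thus ?thesis using simplex_S0_eq[OF \<iota>, of a] Wi(2) Wd(2) eq by (simp add: d_def)
qed

section \<open>Lattice points on lines\<close>

lemma separated_finite_set_spread:
  fixes T :: "real set"
  assumes "finite T" "\<And>s t. s \<in> T \<Longrightarrow> t \<in> T \<Longrightarrow> s < t \<Longrightarrow> t - s \<ge> \<delta>" "T \<noteq> {}"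
  shows "Min T + real (card T - 1) * \<delta> \<le> Max T"
  using assms
proof (induction T rule: finite_linorder_max_induct)
  case (insert b A)
  show ?case
  proof (cases "A = {}")
    case False
    have IH: "Min A + real (card A - 1) * \<delta> \<le> Max A"
      using insert.IH insert.prems False by auto
    have "Max A \<in> A" "Min A \<in> A" using insert.hyps False by auto
    hence *: "Max A < b" "Min A < b" using insert.hyps by auto
    have "b - Max A \<ge> \<delta>" using insert.prems(1)[of "Max A" b] * \<open>Max A \<in> A\<close> by auto
    moreover have "b \<notin> A" using insert.hyps by auto
    moreover have "Min (insert b A) = Min A" "Max (insert b A) = b"
      using insert.hyps(1) False * by (simp_all add: Min_insert Max_insert)
    moreover have "card A > 0" using insert.hyps False by (simp add: card_gt_0_iff)
    ultimately show ?thesis using IH insert.hyps by (simp add: of_nat_diff algebra_simps)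
  qed simp
qed simp

text \<open>Let \<open>w\<close> be the smallest gap between lattice points of \<open>P\<close> on
  \<open>g\<close>. Then \<open>k\<close> such points spread over at least \<open>k - 1\<close>
  steps of \<open>w\<close>, and by convexity \<open>P\<close> contains these steps from the first
  point on.\<close>

lemma lattice_points_on_line:
  fixes P :: "(real ^ 'n) set"
  assumes P: "convex P" and g: "rational_line g"
    and n: "card (P \<inter> integral_points \<inter> g) \<ge> 2"
  obtains p w where "p \<in> P \<inter> integral_points" "w \<in> integral_points" "w \<noteq> 0"
    "p + real (card (P \<inter> integral_points \<inter> g) - 1) *\<^sub>R w \<in> P"
proof -
  let ?S = "P \<inter> integral_points \<inter> g"
  obtain a v where v: "v \<noteq> 0" "g = {a + t *\<^sub>R v | t. True}"
    using g by (auto simp: rational_line_def)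
  define T where "T = {t. a + t *\<^sub>R v \<in> P \<inter> integral_points}"
  have S: "?S = (\<lambda>t. a + t *\<^sub>R v) ` T" by (auto simp: T_def v)
  have inj: "inj_on (\<lambda>t. a + t *\<^sub>R v) T" using v by (auto simp: inj_on_def)
  have card: "card T = card ?S" unfolding S using inj by (simp add: card_image)
  \<comment> \<open>An infinite set has \<open>card\<close> 0, so \<open>n\<close> already excludes
    it.\<close>
  have finT: "finite T" using n card by (metis card.infinite not_numeral_le_zero)
  define \<Delta> where "\<Delta> = {t - s | s t. s \<in> T \<and> t \<in> T \<and> s < t}"
  have "\<Delta> \<subseteq> (\<lambda>(s, t). t - s) ` (T \<times> T)" by (auto simp: \<Delta>_def)
  hence fin\<Delta>: "finite \<Delta>" using finT by (auto intro: finite_subset)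
  have Tne: "T \<noteq> {}" using n card by auto
  obtain s t where "s \<in> T" "t \<in> T" "s \<noteq> t"
    using n card by (metis One_nat_def card_le_Suc0_iff_eq finT not_less_eq_eq numeral_2_eq_2)
  hence "s < t \<or> t < s" by auto
  hence "\<Delta> \<noteq> {}" using \<open>s \<in> T\<close> \<open>t \<in> T\<close> by (auto simp: \<Delta>_def)
  define \<delta> where "\<delta> = Min \<Delta>"
  have "\<delta> \<in> \<Delta>" unfolding \<delta>_def using fin\<Delta> \<open>\<Delta> \<noteq> {}\<close> by (rule Min_in)
  then obtain s1 t1 where st: "\<delta> = t1 - s1" "s1 \<in> T" "t1 \<in> T" "s1 < t1" by (auto simp: \<Delta>_def)
  have "Min T + real (card T - 1) * \<delta> \<le> Max T"
    by (rule separated_finite_set_spread[OF finT _ Tne])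
      (auto simp: \<delta>_def \<Delta>_def intro!: Min_le fin\<Delta>[unfolded \<Delta>_def])
  hence spread: "Min T + real (card ?S - 1) * \<delta> \<le> Max T" by (simp add: card)
  have mm: "Min T \<in> T" "Max T \<in> T" using finT Tne by auto
  define p where "p = a + Min T *\<^sub>R v"
  define w where "w = \<delta> *\<^sub>R v"
  have "w = (a + t1 *\<^sub>R v) - (a + s1 *\<^sub>R v)" by (simp add: w_def st scaleR_diff_left)
  moreover have "a + t1 *\<^sub>R v \<in> integral_points" "a + s1 *\<^sub>R v \<in> integral_points"
    using st by (auto simp: T_def)
  ultimately have "w \<in> integral_points" by (simp only: integral_points_diff)
  moreover have "w \<noteq> 0" using v st by (simp add: w_def)
  moreover have "p \<in> P \<inter> integral_points" using mm by (simp add: p_def T_def)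
  moreover have "p + real (card ?S - 1) *\<^sub>R w \<in> P"
  proof -
    define \<theta> where "\<theta> = real (card ?S - 1) * \<delta> / (Max T - Min T)"
    have pos: "real (card ?S - 1) * \<delta> > 0" using n st by simp
    hence MM: "Max T - Min T > 0" using spread by linarith
    have l01: "0 \<le> \<theta>" "\<theta> \<le> 1"
      unfolding \<theta>_def divide_le_eq_1_pos[OF MM]
      using divide_pos_pos[OF pos MM] spread by linarith+
    have eq: "\<theta> * (Max T - Min T) = real (card ?S - 1) * \<delta>" using MM by (simp add: \<theta>_def)
    have "(1 - \<theta>) *\<^sub>R (a + Min T *\<^sub>R v) + \<theta> *\<^sub>R (a + Max T *\<^sub>R v)
        = a + Min T *\<^sub>R v + (\<theta> * (Max T - Min T)) *\<^sub>R v"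
      by (simp add: algebra_simps)
    also have "\<dots> = p + real (card ?S - 1) *\<^sub>R w" unfolding eq by (simp add: p_def w_def)
    finally have e2: "(1 - \<theta>) *\<^sub>R (a + Min T *\<^sub>R v) + \<theta> *\<^sub>R (a + Max T *\<^sub>R v)
      = p + real (card ?S - 1) *\<^sub>R w" .
    have "(1 - \<theta>) *\<^sub>R (a + Min T *\<^sub>R v) + \<theta> *\<^sub>R (a + Max T *\<^sub>R v) \<in> P"
      using mm l01 by (intro convexD[OF P]) (auto simp: T_def)
    thus ?thesis by (simp only: e2)
  qed
  ultimately show thesis using that by blast
qed

lemma integral_imp_rational_vec: "v \<in> integral_points \<Longrightarrow> rational_vec v"
  using Ints_subset_Rats by (auto simp: integral_points_def rational_vec_def)

text \<open>The edge of the simplex along its last axis carries the multiples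
  \<open>0, ..., s - 1\<close> of a basis vector, where \<open>s\<close> is the last Sylvester term.
  Their preimages under \<open>f\<close> are lattice points of \<open>P\<close> on one line.\<close>

lemma long_line_of_unimodularly_equivalent:
  fixes P :: "(real ^ 'n) set"
  assumes bnd: "bounded P" and eqv: "unimodularly_equivalent P (simplex_S0 \<iota>)"
  obtains g where "rational_line g" "card (P \<inter> integral_points \<inter> g) \<ge> sylvester CARD('n)"
proof -
  obtain f L b where f: "linear L" "\<And>x. f x = L x + b" "bij f"
    "f ` integral_points = integral_points" "f ` P = simplex_S0 \<iota>"
    using eqv unfolding unimodularly_equivalent_def by metis
  define m where "m = sylvester CARD('n) - 1"
  have m: "m \<ge> 1" "real m = real (sylvester CARD('n)) - 1" "sylvester CARD('n) = Suc m"
    using sylvester_ge_2[of "CARD('n)"] by (auto simp: m_def of_nat_diff)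
  define e :: "real ^ 'n" where "e = axis (\<iota> CARD('n)) 1"
  have "e \<in> integral_points" "0 \<in> integral_points" by (auto simp: e_def integral_points_def axis_def)
  then obtain q r where q: "q \<in> integral_points" "f q = 0" and r: "r \<in> integral_points" "f r = e"
    using f(4) by (metis imageE)
  define v where "v = r - q"
  have v: "v \<in> integral_points" unfolding v_def using r(1) q(1) by (rule integral_points_diff)
  have "L v = f r - f q" using f(1) by (simp add: v_def linear_diff f(2))
  hence Lv: "L v = e" by (simp add: q(2) r(2))
  hence "v \<noteq> 0" using f(1) by (auto simp: e_def linear_0 axis_eq_0_iff)
  have fv: "f (q + t *\<^sub>R v) = t *\<^sub>R e" for t
    using q(2) f(1,2) Lv by (simp add: linear_add linear_scale)
  define g where "g = {q + t *\<^sub>R v | t. True}"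
  have "rational_line g"
    unfolding rational_line_def g_def using \<open>v \<noteq> 0\<close> integral_imp_rational_vec[OF v] by blast
  moreover have "card (P \<inter> integral_points \<inter> g) \<ge> sylvester CARD('n)"
  proof -
    have "(\<lambda>k. q + real k *\<^sub>R v) ` {..m} \<subseteq> P \<inter> integral_points \<inter> g"
    proof safe
      fix k assume k: "k \<le> m"
      have S: "0 \<in> simplex_S0 \<iota>" "real m *\<^sub>R e \<in> simplex_S0 \<iota>"
        unfolding simplex_S0_def e_def m(2) by (auto intro!: hull_inc)
      have "(1 - real k / real m) *\<^sub>R 0 + (real k / real m) *\<^sub>R (real m *\<^sub>R e) \<in> simplex_S0 \<iota>"
        using k m S by (intro convexD) (auto simp: simplex_S0_def convex_convex_hull)
      hence "f (q + real k *\<^sub>R v) \<in> f ` P" using m(1) by (simp add: fv f(5))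
      thus "q + real k *\<^sub>R v \<in> P" using f(3) by (auto simp: bij_def inj_def)
      show "q + real k *\<^sub>R v \<in> integral_points"
        by (intro integral_points_add q(1) integral_points_scaleR v) auto
      show "q + real k *\<^sub>R v \<in> g" by (auto simp: g_def)
    qed
    moreover have "finite (P \<inter> integral_points \<inter> g)"
      using finite_bounded_integral_points[OF bnd] by simp
    ultimately have "card ((\<lambda>k. q + real k *\<^sub>R v) ` {..m}) \<le> card (P \<inter> integral_points \<inter> g)"
      by (intro card_mono)
    moreover have "inj_on (\<lambda>k. q + real k *\<^sub>R v) {..m}" using \<open>v \<noteq> 0\<close> by (auto simp: inj_on_def)
    ultimately show ?thesis by (simp add: card_image m(3))
  qed
  ultimately show thesis using that by blast
qed

section \<open>The bound on the lattice diameter and the equality case\<close>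

theorem mainTheorem10:
  fixes P :: "(real ^ 'n) set"
  assumes "polytope P"
    and "aff_dim P = int CARD('n)"
    and "\<forall>v. v extreme_point_of P \<longrightarrow> v \<in> integral_points"
    and "interior P \<inter> integral_points = {}"
    and "\<forall>g. rational_line g \<and> 0 \<in> g \<longrightarrow>
           interior {p + x | p x. p \<in> P \<and> x \<in> g} \<inter> integral_points \<noteq> {}"
  shows "lattice_diameter P \<le> sylvester CARD('n) - 1
       \<and> (lattice_diameter P = sylvester CARD('n) - 1 \<longleftrightarrow>
            (\<exists>\<iota>. bij_betw \<iota> {1..CARD('n)} (UNIV :: 'n set) \<and>
                 unimodularly_equivalent P (simplex_S0 \<iota>)))"
proof -
  let ?s = "sylvester CARD('n)"
  let ?c = "\<lambda>g. card (P \<inter> integral_points \<inter> g)"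
  have cvx: "convex P" and cpt: "compact P"
    using assms(1) polytope_imp_convex polytope_imp_compact by auto
  have bnd: "bounded P" using cpt compact_imp_bounded by auto
  have fin: "finite (P \<inter> integral_points)" using bnd by (rule finite_bounded_integral_points)
  \<comment> \<open>All lattice points of \<open>P\<close>, not just its vertices, serve as
    generators, because the starting point \<open>p\<close> of a segment need not be a
    vertex.\<close>
  have hull: "P = convex hull (P \<inter> integral_points)"
  proof
    have "{v. v extreme_point_of P} \<subseteq> P \<inter> integral_points"
      using assms(3) by (auto simp: extreme_point_of_def)
    thus "P \<subseteq> convex hull (P \<inter> integral_points)"
      using Krein_Milman_Minkowski[OF cpt cvx] by (metis hull_mono)
    show "convex hull (P \<inter> integral_points) \<subseteq> P" using cvx by (intro hull_minimal) auto
  qed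
  have full: "affine hull P = UNIV" using assms(2) aff_dim_eq_full[of P] by simp
  have segment: "\<exists>x. lattice_free_segment P (P \<inter> integral_points) p w x (real (?c g - 1))"
    if "p \<in> P \<inter> integral_points" "w \<in> integral_points" "w \<noteq> 0"
      "p + real (?c g - 1) *\<^sub>R w \<in> P" "?c g \<ge> 2" for p w g
  proof -
    define h where "h = {0 + t *\<^sub>R w | t. True}"
    have "rational_line h" unfolding rational_line_def h_def
      using that(2,3) integral_imp_rational_vec by blast
    moreover have "0 \<in> h" by (auto simp: h_def intro!: exI[of _ 0])
    ultimately obtain x where x: "x \<in> interior {p + x | p x. p \<in> P \<and> x \<in> h}" "x \<in> integral_points"
      using assms(5) by blast
    have "{p + x | p x. p \<in> P \<and> x \<in> h} = {q + t *\<^sub>R w | q t. q \<in> P}" by (auto simp: h_def)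
    hence "lattice_free_segment P (P \<inter> integral_points) p w x (real (?c g - 1))"
      using that x by unfold_locales (use hull fin full assms(4) in auto)
    thus ?thesis ..
  qed
  have le: "?c g \<le> ?s" if "rational_line g" for g
  proof (cases "?c g \<ge> 2")
    case True
    from lattice_points_on_line[OF cvx that True] obtain p w where
      "p \<in> P \<inter> integral_points" "w \<in> integral_points" "w \<noteq> 0" "p + real (?c g - 1) *\<^sub>R w \<in> P" .
    from segment[OF this True] obtain x where
      "lattice_free_segment P (P \<inter> integral_points) p w x (real (?c g - 1))" by blast
    from lattice_free_segment.segment_length_bound(1)[OF this] show ?thesis
      using True by (simp add: of_nat_diff)
  next
    case False
    thus ?thesis using sylvester_ge_2[of "CARD('n)"] by simp
  qed
  have ex: "\<exists>\<iota>. bij_betw \<iota> {1..CARD('n)} (UNIV :: 'n set) \<and> unimodularly_equivalent P (simplex_S0 \<iota>)"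
    if g: "rational_line g" "?c g = ?s" for g
  proof -
    have c2: "?c g \<ge> 2" using g(2) sylvester_ge_2[of "CARD('n)"] by simp
    from lattice_points_on_line[OF cvx g(1) c2] obtain p w where
      "p \<in> P \<inter> integral_points" "w \<in> integral_points" "w \<noteq> 0" "p + real (?c g - 1) *\<^sub>R w \<in> P" .
    from segment[OF this c2] obtain x where
      seg: "lattice_free_segment P (P \<inter> integral_points) p w x (real (?c g - 1))" by blast
    obtain \<iota> where \<iota>: "bij_betw \<iota> {1..CARD('n)} (UNIV :: 'n set)"
      using ex_bij_betw_nat_finite_1[of "UNIV :: 'n set"] by auto
    have "real (?c g - 1) = real ?s - 1" using g(2) c2 by (simp add: of_nat_diff)
    from lattice_free_segment.extremal_simplex[OF seg this \<iota>] \<iota> show ?thesis by blast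
  qed
  define S where "S = ?c ` {g. rational_line g}"
  have ld: "lattice_diameter P = Sup S - 1" by (simp add: lattice_diameter_def S_def)
  have Sle: "k \<le> ?s" if "k \<in> S" for k using that le by (auto simp: S_def)
  \<comment> \<open>A bounded set of naturals is finite, so its supremum is attained by some
    line.\<close>
  hence bdd: "bdd_above S" and finS: "finite S" by (auto simp: bdd_above_def finite_nat_set_iff_bounded_le)
  have "axis undefined 1 \<noteq> (0 :: real ^ 'n)" "rational_vec (axis undefined 1 :: real ^ 'n)"
    by (simp add: axis_eq_0_iff) (simp add: rational_vec_def axis_def)
  hence "rational_line {0 + t *\<^sub>R (axis undefined 1 :: real ^ 'n) | t. True}"
    unfolding rational_line_def by blast
  hence Sne: "S \<noteq> {}" by (auto simp: S_def)
  have SupS: "Sup S \<in> S" using finS Sne by (simp add: cSup_eq_Max Max_in)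
  have "Sup S \<le> ?s" using SupS Sle by blast
  hence "lattice_diameter P \<le> ?s - 1" by (simp add: ld)
  moreover have "\<exists>\<iota>. bij_betw \<iota> {1..CARD('n)} (UNIV :: 'n set) \<and> unimodularly_equivalent P (simplex_S0 \<iota>)"
    if "lattice_diameter P = ?s - 1"
  proof -
    \<comment> \<open>As \<open>?s \<ge> 2\<close>, the truncated subtraction of 1 can be
      undone.\<close>
    have "Sup S = ?s" using that ld sylvester_ge_2[of "CARD('n)"] by linarith
    then obtain g where "rational_line g" "?c g = ?s" using SupS by (auto simp: S_def)
    thus ?thesis by (rule ex)
  qed
  moreover have "lattice_diameter P = ?s - 1"
    if \<iota>: "bij_betw \<iota> {1..CARD('n)} (UNIV :: 'n set)" "unimodularly_equivalent P (simplex_S0 \<iota>)" for \<iota>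
  proof -
    obtain g where g: "rational_line g" "?c g \<ge> ?s"
      using long_line_of_unimodularly_equivalent[OF bnd \<iota>(2)] by blast
    have "?c g \<le> Sup S" using g(1) bdd by (intro cSup_upper) (auto simp: S_def)
    hence "Sup S = ?s" using g(2) \<open>Sup S \<le> ?s\<close> by linarith
    thus ?thesis by (simp add: ld)
  qed
  ultimately show ?thesis by blast
qed

end
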